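(* Let $f:[0,1]\to\mathbb C$ with $\|f\|_\infty<\infty$, $f\in\mathcal L^1_1([0,1])$, and $\widehat T_1^k(\mathbb 1_{Y_k}f)\in\mathrm{BV}(Y)$ for all $k\in\mathbb N_0$. If $$\sum_{k=0}^{\infty}\big\|\widehat T_1^k(\mathbb 1_{Y_k}f)\big\|_\infty<\infty,$$ then for every $x\in Y$, $\lim_{n\to\infty}\ln(n)\cdot\widehat T_1^n(f)(x)=\int f\,\mathrm{d}\mu_1$.
   Context: $T_1$ is the Farey map: $T_1(x)=\frac x{1-x}$ ($x\le1/2$), $\frac{1-x}x$ ($x>1/2$), inverse branches $f_{1,0}(x)=\frac x{1+x}$, $f_{1,1}(x)=\frac1{1+x}$. $\mu_1$ has density $h_1(x)=1/x$; $\mathcal L^1_1([0,1])$ is the space of $\mu_1$-integrable functions. $\mathcal P_1 f=|f_{1,0}'|\,f\circ f_{1,0}+|f_{1,1}'|\,f\circ f_{1,1}$ and $\widehat T_1(f)=\mathcal P_1(fh_1)/h_1$. $Y=[1/2,1]$, $Y_0=Y$ and $Y_k=T_1^{-k}(Y)\setminus\bigcup_{j<k}T_1^{-j}(Y)=[1/(k+2),1/(k+1))$ for $k\ge1$. $\mathrm{BV}(Y)$ is the space of right-continuous $g:[0,1]\to\mathbb C$ supported in $Y$ of bounded variation; $\|\cdot\|_\infty$ is the sup norm. *)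

theory Defs
  imports "HOL-Analysis.Analysis"
begin

text \<open>Inverse branches of the Farey map.\<close>
definition f10 :: "real \<Rightarrow> real" where "f10 x = x / (1 + x)"
definition f11 :: "real \<Rightarrow> real" where "f11 x = 1 / (1 + x)"

definition df10 :: "real \<Rightarrow> real" where "df10 x = 1 / (1 + x)^2"
definition df11 :: "real \<Rightarrow> real" where "df11 x = - 1 / (1 + x)^2"

definition h1 :: "real \<Rightarrow> real" where "h1 x = 1 / x"

definition P1 :: "(real \<Rightarrow> complex) \<Rightarrow> real \<Rightarrow> complex" where
  "P1 f x = complex_of_real \<bar>df10 x\<bar> * f (f10 x) + complex_of_real \<bar>df11 x\<bar> * f (f11 x)"

definition That1 :: "(real \<Rightarrow> complex) \<Rightarrow> real \<Rightarrow> complex" where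
  "That1 f x = P1 (\<lambda>y. f y * complex_of_real (h1 y)) x / complex_of_real (h1 x)"

definition mu1 :: "real measure" where
  "mu1 = density lebesgue (\<lambda>x. ennreal (indicator {0..1} x * h1 x))"

definition Y :: "real set" where "Y = {1/2..1}"

definition Yk :: "nat \<Rightarrow> real set" where
  "Yk k = (if k = 0 then Y else {1 / real (k + 2) ..< 1 / real (k + 1)})"

definition supnorm :: "(real \<Rightarrow> complex) \<Rightarrow> real" where
  "supnorm g = (SUP x\<in>{0..1}. norm (g x))"

definition bounded_variation01 :: "(real \<Rightarrow> complex) \<Rightarrow> bool" where
  "bounded_variation01 g \<longleftrightarrow> (\<exists>B. \<forall>(n::nat) (t::nat \<Rightarrow> real).
      0 \<le> t 0 \<and> t n \<le> 1 \<and> (\<forall>i<n. t i \<le> t (Suc i)) \<longrightarrow>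
      (\<Sum>i<n. norm (g (t (Suc i)) - g (t i))) \<le> B)"

definition BV_Y :: "(real \<Rightarrow> complex) \<Rightarrow> bool" where
  "BV_Y g \<longleftrightarrow> (\<forall>x\<in>{0..<1}. continuous (at_right x) g)
     \<and> (\<forall>x\<in>{0..1} - Y. g x = 0) \<and> bounded_variation01 g"

end

theory Submission
  imports Defs "HOL-Real_Asymp.Real_Asymp"
begin

text \<open>
  On \<open>(0, 1]\<close> the operator is \<open>g \<mapsto> (g (x/(1+x)) + x g (1/(1+x))) / (1+x)\<close>. It preserves nonnegative
  increasing concave functions, and by Jensen's inequality it decreases them on \<open>Y\<close>. For such \<open>f\<close> put
  \<open>u n = T^n f\<close>. Decomposing the mass at time \<open>n\<close> by the last visit to \<open>Y\<close> writes \<open>\<integral> f d\<mu>\<close>, up to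
  \<open>o(1)\<close>, as the sum over \<open>i < n\<close> of the integrals of \<open>u (n-1-i)\<close> over \<open>((i+1)/(i+2), 1]\<close>, a set of
  measure \<open>ln ((i+2)/(i+1))\<close>. Monotonicity in \<open>n\<close> turns this into \<open>u n (1/2) ln n \<le> \<integral> f d\<mu> + o(1)\<close> and
  \<open>u n 1 ln n \<ge> \<integral> f d\<mu> - o(1)\<close>, and both bounds meet because \<open>u (n+1) 1 = u n (1/2)\<close>.
  Differences of such functions contain all \<open>x p(x)\<close> with \<open>p\<close> a polynomial; as the operator is positive,
  sandwiching extends the limit to functions of bounded variation supported in \<open>Y\<close>. A general \<open>f\<close>
  is split over the sets \<open>Yk k\<close>, so that \<open>T^n f\<close> is on \<open>Y\<close> the convolution of the \<open>T^(n-k)\<close> with the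
  functions \<open>T^k (1_Yk f)\<close>; their sup norms are summable and, as \<open>f\<close> is bounded, \<open>O(1/k)\<close>.
\<close>

section \<open>The transfer operator in normalized form\<close>

text \<open>Conjugation by the density 1/x turns the coefficients of \<open>P1\<close> into weights
  that are nonnegative and add up to 1 for x \<ge> 0. The value type is general so that complex
  functions and their real majorants share the same lemmas.\<close>

definition farey_op :: "(real \<Rightarrow> 'a::real_vector) \<Rightarrow> real \<Rightarrow> 'a" where
  "farey_op g x = (1 / (1 + x)) *\<^sub>R g (x / (1 + x)) + (x / (1 + x)) *\<^sub>R g (1 / (1 + x))"

lemma farey_op_funpow_Suc:
  "(farey_op ^^ Suc n) g x =
    (1 / (1 + x)) *\<^sub>R (farey_op ^^ n) g (x / (1 + x)) + (x / (1 + x)) *\<^sub>R (farey_op ^^ n) g (1 / (1 + x))"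
  unfolding funpow.simps comp_apply by (rule farey_op_def)

lemma That1_eq_farey_op: "That1 g x = farey_op g x" if "x > 0"
proof -
  define s where "s = 1 + x"
  have s: "s > 0" "x = s - 1" "s \<noteq> 1" using that by (auto simp: s_def)
  show ?thesis
    using s unfolding That1_def P1_def df10_def df11_def f10_def f11_def h1_def farey_op_def
      s_def[symmetric]
    by (simp add: scaleR_conv_of_real power2_eq_square divide_simps)
qed

lemma That1_funpow_eq: "(That1 ^^ n) g x = (farey_op ^^ n) g x" if "x > 0"
  using that
proof (induction n arbitrary: x)
  case (Suc n)
  have "x / (1 + x) > 0" "1 / (1 + x) > 0" using Suc.prems by auto
  then show ?case using Suc
    by (simp add: That1_eq_farey_op farey_op_funpow_Suc del: funpow.simps(2))
      (simp add: That1_eq_farey_op farey_op_def[of "(That1 ^^ n) g"])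
qed simp

text \<open>Both inverse branches map [1/N, 1] into [1/(N+1), 1], so on [1/N, 1] the n-th iterate
  only sees values on [1/(N+n), 1].\<close>

lemma farey_op_funpow_cong_local:
  assumes "\<And>y. 1 / real (N + n) \<le> y \<Longrightarrow> y \<le> 1 \<Longrightarrow> f y = g y"
    and "N > 0" "1 / real N \<le> x" "x \<le> 1"
  shows "(farey_op ^^ n) f x = (farey_op ^^ n) g x"
  using assms
proof (induction n arbitrary: x N)
  case (Suc n)
  have x: "x > 0" using Suc.prems(2,3) by (smt (verit) divide_pos_pos of_nat_0_less_iff)
  have "1 \<le> real N * x" using Suc.prems(2,3) by (simp add: field_simps)
  then have a: "1 / real (Suc N) \<le> x / (1 + x)" using x by (simp add: field_simps)
  have "real N \<ge> 1" using Suc.prems(2) by linarith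
  then have b: "1 / real (Suc N) \<le> 1 / (1 + x)" using x Suc.prems(4) by (intro divide_left_mono) auto
  have "(farey_op ^^ n) f y = (farey_op ^^ n) g y" if "1 / real (Suc N) \<le> y" "y \<le> 1" for y
    using Suc.IH[of "Suc N" y] Suc.prems(1) that by simp
  then show ?case using a b x by (simp add: farey_op_funpow_Suc del: funpow.simps)
qed simp

lemma farey_op_funpow_add:
  "(farey_op ^^ n) (\<lambda>x. f x + g x) = (\<lambda>x. (farey_op ^^ n) f x + (farey_op ^^ n) g x)"
  by (induction n) (auto simp: farey_op_funpow_Suc algebra_simps simp del: funpow.simps(2))

lemma farey_op_funpow_linear:
  assumes "linear L"
  shows "(farey_op ^^ n) (\<lambda>x. L (f x)) = (\<lambda>x. L ((farey_op ^^ n) f x))"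
  using assms by (induction n) (auto simp: farey_op_funpow_Suc simp del: funpow.simps(2) simp: linear_add linear_scale)

lemma farey_op_funpow_sum:
  "(farey_op ^^ n) (\<lambda>x. \<Sum>i\<in>I. f i x) = (\<lambda>x. \<Sum>i\<in>I. (farey_op ^^ n) (f i) x)"
  by (induction n) (auto simp: farey_op_funpow_Suc sum.distrib scaleR_sum_right simp del: funpow.simps(2))

text \<open>The weights are nonnegative on (0, 1], so the operator is positive and a pointwise
  majorant passes through the iterates.\<close>

lemma farey_op_funpow_norm_le:
  assumes "\<And>y. 0 < y \<Longrightarrow> y \<le> 1 \<Longrightarrow> norm (f y) \<le> e y" "0 < x" "x \<le> 1"
  shows "norm ((farey_op ^^ n) f x) \<le> (farey_op ^^ n) e x"
  using assms(2,3)
proof (induction n arbitrary: x)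
  case (Suc n)
  have "0 < x / (1 + x)" "x / (1 + x) \<le> 1" "0 < 1 / (1 + x)" "1 / (1 + x) \<le> 1"
    using Suc.prems by auto
  note IH = Suc.IH[OF this(1,2)] Suc.IH[OF this(3,4)]
  have "norm ((farey_op ^^ Suc n) f x) \<le>
    norm ((1 / (1 + x)) *\<^sub>R (farey_op ^^ n) f (x / (1 + x))) +
    norm ((x / (1 + x)) *\<^sub>R (farey_op ^^ n) f (1 / (1 + x)))"
    unfolding farey_op_funpow_Suc by (rule norm_triangle_ineq)
  also have "\<dots> \<le> (1 / (1 + x)) *\<^sub>R (farey_op ^^ n) e (x / (1 + x)) +
     (x / (1 + x)) *\<^sub>R (farey_op ^^ n) e (1 / (1 + x))"
    unfolding norm_scaleR real_scaleR_def using Suc.prems IH by (intro add_mono mult_mono) auto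
  finally show ?case by (simp only: farey_op_funpow_Suc)
qed (use assms in auto)

section \<open>Increasing concave functions\<close>

text \<open>Explicit derivatives make invariance under the operator a computation. They exist on all
  of x > 0 so that two-sided derivatives are available at 1; the signs concern (0, 1] only.\<close>

definition inc_concave :: "(real \<Rightarrow> real) \<Rightarrow> bool" where
  "inc_concave f \<longleftrightarrow> (\<exists>f' f''.
     (\<forall>x>0. (f has_real_derivative f' x) (at x) \<and> (f' has_real_derivative f'' x) (at x)) \<and>
     (\<forall>x\<in>{0<..1}. 0 \<le> f x \<and> 0 \<le> f' x \<and> f'' x \<le> 0))"

lemma inc_concave_mono:
  assumes "inc_concave f" "0 < x" "x \<le> y" "y \<le> 1"
  shows "f x \<le> f y"
proof -
  obtain f' where f': "\<And>x. x > 0 \<Longrightarrow> (f has_real_derivative f' x) (at x)"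
    "\<And>x. x \<in> {0<..1} \<Longrightarrow> 0 \<le> f' x"
    using assms(1) unfolding inc_concave_def by blast
  show ?thesis
  proof (rule DERIV_nonneg_imp_nondecreasing[OF assms(3)])
    fix z assume "x \<le> z" "z \<le> y"
    then have "z > 0" "z \<in> {0<..1}" using assms by auto
    then show "\<exists>d. (f has_real_derivative d) (at z) \<and> 0 \<le> d" using f' by blast
  qed
qed

text \<open>With a = x/(1+x) \<le> b = 1/(1+x), monotonicity gives f a \<le> f b and concavity gives
  x f' b \<le> f' b \<le> f' a.\<close>

lemma inc_concave_farey_op:
  assumes "inc_concave f"
  shows "inc_concave (farey_op f)"
proof -
  obtain f' f'' where D: "\<And>x. x > 0 \<Longrightarrow> (f has_real_derivative f' x) (at x)"
    "\<And>x. x > 0 \<Longrightarrow> (f' has_real_derivative f'' x) (at x)"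
    and pos: "\<And>x. x \<in> {0<..1} \<Longrightarrow> 0 \<le> f x" "\<And>x. x \<in> {0<..1} \<Longrightarrow> 0 \<le> f' x"
      "\<And>x. x \<in> {0<..1} \<Longrightarrow> f'' x \<le> 0"
    using assms unfolding inc_concave_def by blast
  have f'_anti: "f' y \<le> f' x" if "0 < x" "x \<le> y" "y \<le> 1" for x y
  proof (rule DERIV_nonpos_imp_nonincreasing[OF that(2)])
    fix z assume "x \<le> z" "z \<le> y"
    then have "z > 0" "z \<in> {0<..1}" using that by auto
    then show "\<exists>d. (f' has_real_derivative d) (at z) \<and> d \<le> 0" using D(2) pos(3) by blast
  qed
  \<comment> \<open>The first two derivatives of \<open>farey_op f\<close>, grouped so that each
    summand has a definite sign on (0, 1].\<close>
  define g' where "g' x = (f (1 / (1 + x)) - f (x / (1 + x))) / (1 + x)^2 +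
      (f' (x / (1 + x)) - x * f' (1 / (1 + x))) / (1 + x)^3" for x
  define g'' where "g'' x = - 2 * (f (1 / (1 + x)) - f (x / (1 + x))) / (1 + x)^3
      - 4 * f' (x / (1 + x)) / (1 + x)^4 - (2 - 2 * x) * f' (1 / (1 + x)) / (1 + x)^4
      + (f'' (x / (1 + x)) + x * f'' (1 / (1 + x))) / (1 + x)^5" for x
  have ca: "((\<lambda>x. h (x / (1 + x))) has_real_derivative h' / (1 + x)^2) (at x)"
    if "(h has_real_derivative h') (at (x / (1 + x)))" "x > 0" for h h' x
    by (rule DERIV_chain2[where g = "\<lambda>x. x / (1 + x)", OF that(1), THEN DERIV_cong])
      (use that(2) in \<open>auto intro!: derivative_eq_intros simp: power2_eq_square divide_simps\<close>)
  have cb: "((\<lambda>x. h (1 / (1 + x))) has_real_derivative - h' / (1 + x)^2) (at x)"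
    if "(h has_real_derivative h') (at (1 / (1 + x)))" "x > 0" for h h' x
    by (rule DERIV_chain2[where g = "\<lambda>x. 1 / (1 + x)", OF that(1), THEN DERIV_cong])
      (use that(2) in \<open>auto intro!: derivative_eq_intros simp: power2_eq_square divide_simps\<close>)
  have "(farey_op f has_real_derivative g' x) (at x) \<and> (g' has_real_derivative g'' x) (at x)"
    if x: "x > 0" for x
  proof -
    define s where "s = 1 + x"
    have s: "s > 0" "x = s - 1" using x by (auto simp: s_def)
    have ab: "x / (1 + x) > 0" "1 / (1 + x) > 0" using x by auto
    note fa = ca[OF D(1)[OF ab(1)] x] and f'a = ca[OF D(2)[OF ab(1)] x]
      and fb = cb[OF D(1)[OF ab(2)] x] and f'b = cb[OF D(2)[OF ab(2)] x]
    have r1: "((\<lambda>x. 1 / (1 + x)) has_real_derivative - 1 / (1 + x)^2) (at x)"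
      and r2: "((\<lambda>x. 1 / (1 + x)^2) has_real_derivative - 2 / (1 + x)^3) (at x)"
      and r3: "((\<lambda>x. 1 / (1 + x)^3) has_real_derivative - 3 / (1 + x)^4) (at x)"
      using x by (auto intro!: derivative_eq_intros simp: eval_nat_numeral divide_simps)
    have "((\<lambda>x. f (x / (1 + x)) * (1 / (1 + x)) + x * (f (1 / (1 + x)) * (1 / (1 + x))))
       has_real_derivative g' x) (at x)"
      unfolding g'_def s_def[symmetric]
      by (rule DERIV_cong[OF DERIV_add[OF DERIV_mult[OF fa r1] DERIV_mult[OF DERIV_ident DERIV_mult[OF fb r1]]]])
        (use s(1) in \<open>simp add: s_def[symmetric], simp add: s(2) power2_eq_square power3_eq_cube divide_simps, simp add: algebra_simps\<close>)
    then have 1: "(farey_op f has_real_derivative g' x) (at x)"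
      by (simp add: farey_op_def[abs_def])
    have "((\<lambda>x. (f (1 / (1 + x)) - f (x / (1 + x))) * (1 / (1 + x) ^ 2)
        + (f' (x / (1 + x)) - x * f' (1 / (1 + x))) * (1 / (1 + x) ^ 3)) has_real_derivative g'' x) (at x)"
      unfolding g''_def s_def[symmetric]
      by (rule DERIV_cong[OF DERIV_add[OF DERIV_mult[OF DERIV_diff[OF fb fa] r2]
           DERIV_mult[OF DERIV_diff[OF f'a DERIV_mult[OF DERIV_ident f'b]] r3]]])
        (use s(1) in \<open>simp add: s_def[symmetric], simp add: s(2) eval_nat_numeral divide_simps, simp add: algebra_simps\<close>)
    then have 2: "(g' has_real_derivative g'' x) (at x)"
      by (simp add: g'_def[abs_def])
    show ?thesis using 1 2 by blast
  qed
  moreover have "0 \<le> farey_op f x \<and> 0 \<le> g' x \<and> g'' x \<le> 0" if x: "x \<in> {0<..1}" for x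
  proof -
    define a b where "a = x / (1 + x)" and "b = 1 / (1 + x)"
    have ab: "a \<in> {0<..1}" "b \<in> {0<..1}" "a \<le> b" using x by (auto simp: a_def b_def divide_right_mono)
    have fab: "f a \<le> f b" using inc_concave_mono[OF assms] ab by auto
    have f'ab: "f' b \<le> f' a" using f'_anti ab by auto
    have "x * f' b \<le> 1 * f' b" using x pos(2)[OF ab(2)] by (intro mult_right_mono) auto
    then have 1: "0 \<le> f' a - x * f' b" using f'ab by linarith
    have 2: "0 \<le> farey_op f x" using pos(1)[OF ab(1)] pos(1)[OF ab(2)] ab
      unfolding farey_op_def a_def[symmetric] b_def[symmetric] by simp
    have 3: "0 \<le> g' x" unfolding g'_def a_def[symmetric] b_def[symmetric] using 1 fab x by simp
    have 4: "0 \<le> (f b - f a) / (1 + x)^3" using fab x by simp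
    have 5: "0 \<le> f' a / (1 + x)^4" "0 \<le> (2 - 2 * x) * f' b / (1 + x)^4"
      using pos(2)[OF ab(1)] pos(2)[OF ab(2)] x by auto
    have 6: "(f'' a + x * f'' b) / (1 + x)^5 \<le> 0"
      using pos(3)[OF ab(1)] pos(3)[OF ab(2)] x
      by (intro divide_nonpos_nonneg add_nonpos_nonpos mult_nonneg_nonpos) auto
    have 7: "g'' x = - 2 * ((f b - f a) / (1 + x)^3) - 4 * (f' a / (1 + x)^4)
       - (2 - 2 * x) * f' b / (1 + x)^4 + (f'' a + x * f'' b) / (1 + x)^5"
      unfolding g''_def a_def[symmetric] b_def[symmetric] by simp
    show ?thesis using 2 3 4 5 6 7 by linarith
  qed
  ultimately show ?thesis unfolding inc_concave_def by blast
qed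

lemma inc_concave_farey_op_funpow: "inc_concave f \<Longrightarrow> inc_concave ((farey_op ^^ n) f)"
  by (induction n) (auto intro: inc_concave_farey_op)

text \<open>The image at x is a convex combination of f at the two branch points, so Jensen bounds
  it by f at their barycentre 2x/(1+x)^2. That point is at most x once (1+x)^2 \<ge> 2, which holds
  on \<open>Y\<close>.\<close>

lemma farey_op_le_of_inc_concave:
  assumes "inc_concave f" "x \<in> {1/2..1}"
  shows "farey_op f x \<le> f x"
proof -
  obtain f' f'' where D: "\<And>x. x > 0 \<Longrightarrow> (f has_real_derivative f' x) (at x)"
    "\<And>x. x > 0 \<Longrightarrow> (f' has_real_derivative f'' x) (at x)"
    and pos: "\<And>x. x \<in> {0<..1} \<Longrightarrow> f'' x \<le> 0"
    using assms unfolding inc_concave_def by blast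
  define a b where "a = x / (1 + x)" and "b = 1 / (1 + x)"
  have ab: "a \<in> {0<..1}" "b \<in> {0<..1}" using assms by (auto simp: a_def b_def)
  have cv: "convex_on {0<..1} (\<lambda>x. - f x)"
    by (rule f''_ge0_imp_convex[where f' = "\<lambda>x. - f' x" and f'' = "\<lambda>x. - f'' x"])
      (use D pos in \<open>auto intro!: derivative_eq_intros\<close>)
  have "- f ((1 - x / (1 + x)) *\<^sub>R a + (x / (1 + x)) *\<^sub>R b) \<le>
     (1 - x / (1 + x)) * (- f a) + (x / (1 + x)) * (- f b)"
    using ab assms by (intro convex_onD[OF cv]) (auto simp: field_simps)
  moreover have w: "1 - x / (1 + x) = 1 / (1 + x)" using assms by (simp add: field_simps)
  moreover have "farey_op f x = (1 / (1 + x)) * f a + (x / (1 + x)) * f b"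
    by (simp add: farey_op_def a_def b_def)
  ultimately have 1: "farey_op f x \<le> f ((1 / (1 + x)) * a + (x / (1 + x)) * b)" by simp
  have e: "(1 / (1 + x)) * a + (x / (1 + x)) * b = 2 * x / (1 + x)^2"
    using assms by (simp add: a_def b_def power2_eq_square field_simps)
  have "(1 + x)^2 \<ge> (1 + 1/2)^2" using assms by (intro power_mono) auto
  then have "2 \<le> (1 + x)^2" by (simp add: power2_eq_square)
  then have "x * 2 \<le> x * (1 + x)^2" using assms by (intro mult_left_mono) auto
  then have "2 * x / (1 + x)^2 \<le> x" using assms by (simp add: field_simps)
  then have "f (2 * x / (1 + x)^2) \<le> f x"
    using assms(2) by (intro inc_concave_mono[OF assms(1)]) auto
  with 1 e show ?thesis by simp
qed

section \<open>Renewal equation and asymptotics for increasing concave functions\<close>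

lemma cesaro_tendsto_0:
  fixes u :: "nat \<Rightarrow> real"
  assumes "u \<longlonglongrightarrow> 0" "\<And>n. u n \<ge> 0"
  shows "(\<lambda>n. (\<Sum>j<n. u j) / real n) \<longlonglongrightarrow> 0"
proof (rule LIMSEQ_I)
  fix e :: real assume e: "e > 0"
  obtain N where N: "\<And>n. n \<ge> N \<Longrightarrow> u n < e / 2"
    using order_tendstoD(2)[OF assms(1), of "e/2"] e by (auto simp: eventually_sequentially)
  define C where "C = (\<Sum>j<N. u j)"
  have C: "C \<ge> 0" unfolding C_def using assms(2) by (intro sum_nonneg) auto
  obtain M where M: "real M > 2 * C / e" using reals_Archimedean2 by blast
  have "norm ((\<Sum>j<n. u j) / real n - 0) < e" if n: "n \<ge> max (Suc N) (Suc M)" for n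
  proof -
    have np: "real n > 0" using n by auto
    have "(\<Sum>j<n. u j) = C + (\<Sum>j=N..<n. u j)"
      unfolding C_def using n
      by (metis atLeast0LessThan le_Suc_eq max.bounded_iff nat_le_linear not_less_eq_eq sum.atLeastLessThan_concat zero_le)
    also have "(\<Sum>j=N..<n. u j) \<le> (\<Sum>j=N..<n. e / 2)"
      using N by (intro sum_mono) (auto intro: less_imp_le)
    also have "\<dots> \<le> real n * (e / 2)" using e n by (auto intro!: mult_right_mono)
    finally have 1: "(\<Sum>j<n. u j) \<le> C + real n * (e / 2)" by simp
    have "2 * C < e * real M" using M e by (simp add: field_simps)
    also have "\<dots> \<le> e * real n" using n e by (intro mult_left_mono) auto
    finally have "(\<Sum>j<n. u j) < e * real n" using 1 by (simp add: field_simps)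
    then have "(\<Sum>j<n. u j) / real n < e" using np by (simp add: field_simps)
    moreover have "(\<Sum>j<n. u j) / real n \<ge> 0" using assms(2) by (simp add: sum_nonneg)
    ultimately show ?thesis by simp
  qed
  then show "\<exists>no. \<forall>n\<ge>no. norm ((\<Sum>j<n. u j) / real n - 0) < e" by blast
qed

text \<open>Both inverse branches send 1 to 1/2, each with weight 1/2.\<close>

lemma farey_op_funpow_at_1: "(farey_op ^^ Suc n) f 1 = (farey_op ^^ n) f (1/2)"
  unfolding farey_op_funpow_Suc by (simp flip: scaleR_add_left)

text \<open>If \<open>V' x = u x / x\<close> then \<open>farey_distr V\<close> is related to \<open>farey_op u\<close> in the same way: \<open>V\<close> plays the
  role of the distribution function of the measure with density \<open>u\<close> with respect to \<open>mu1\<close>.\<close>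

definition farey_distr :: "(real \<Rightarrow> real) \<Rightarrow> real \<Rightarrow> real" where
  "farey_distr V x = V (x / (1 + x)) - V (1 / (1 + x)) + V 1"

lemma farey_distr_funpow_Suc:
  "(farey_distr ^^ Suc n) V x = (farey_distr ^^ n) V (x / (1 + x)) - (farey_distr ^^ n) V (1 / (1 + x))
     + (farey_distr ^^ n) V 1"
  unfolding funpow.simps comp_apply by (rule farey_distr_def)

text \<open>By the chain rule the two branches contribute u(x/(1+x)) / (x(1+x)) and u(1/(1+x)) /
  (1+x), whose sum is \<open>farey_op u x / x\<close>.\<close>

lemma farey_distr_deriv:
  assumes "\<And>x. x > 0 \<Longrightarrow> (V has_real_derivative u x / x) (at x)" "x > 0"
  shows "((farey_distr ^^ n) V has_real_derivative (farey_op ^^ n) u x / x) (at x)"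
  using assms(2)
proof (induction n arbitrary: x)
  case (Suc n)
  define s where "s = 1 + x"
  have s: "s > 1" "x = s - 1" using Suc.prems by (auto simp: s_def)
  have "x / (1 + x) > 0" "1 / (1 + x) > 0" using Suc.prems by auto
  note IH = Suc.IH[OF this(1)] Suc.IH[OF this(2)]
  have a: "((\<lambda>x. x / (1 + x)) has_real_derivative 1 / (1 + x)^2) (at x)"
    and b: "((\<lambda>x. 1 / (1 + x)) has_real_derivative - 1 / (1 + x)^2) (at x)"
    using Suc.prems by (auto intro!: derivative_eq_intros simp: power2_eq_square divide_simps)
  have "((\<lambda>x. (farey_distr ^^ n) V (x / (1 + x)) - (farey_distr ^^ n) V (1 / (1 + x))
     + (farey_distr ^^ n) V 1) has_real_derivative (farey_op ^^ Suc n) u x / x) (at x)"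
    unfolding farey_op_funpow_Suc
    apply (rule DERIV_cong[OF DERIV_add[OF DERIV_diff[OF
       DERIV_chain2[where g = "\<lambda>x. x / (1 + x)", OF IH(1) a]
       DERIV_chain2[where g = "\<lambda>x. 1 / (1 + x)", OF IH(2) b]] DERIV_const]])
    unfolding s_def[symmetric] using s(1)
    by (simp add: s(2) divide_simps) (simp add: algebra_simps power2_eq_square)
  moreover have "(farey_distr ^^ Suc n) V = (\<lambda>x. (farey_distr ^^ n) V (x / (1 + x)) -
      (farey_distr ^^ n) V (1 / (1 + x)) + (farey_distr ^^ n) V 1)"
    by (rule ext) (rule farey_distr_funpow_Suc)
  ultimately show ?case by simp
qed (use assms in auto)

text \<open>Conservation of mass: at 1 the two branch points coincide and their contributions
  cancel.\<close>

lemma farey_distr_funpow_at_1: "(farey_distr ^^ n) V 1 = V 1"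
  by (induction n) (simp_all add: farey_distr_funpow_Suc del: funpow.simps(2))

text \<open>Up to endpoints, the preimage of (0, 1/(k+1)] under the Farey map consists of (0,
  1/(k+2)] and ((k+1)/(k+2), 1]. Iterating on the first piece peels off one increment next to 1 per
  time step; the last term is the initial mass still on its way out from 0. The case k = 0 is the
  one of interest, general k serves the induction.\<close>

lemma farey_distr_renewal:
  "(farey_distr ^^ n) V (1 / real (k + 1)) =
    (\<Sum>i<n. V 1 - (farey_distr ^^ (n - 1 - i)) V (real (k + i + 1) / real (k + i + 2))) + V (1 / real (k + n + 1))"
proof (induction n arbitrary: k)
  case (Suc n)
  define y where "y = 1 / real (k + 1)"
  have y: "y / (1 + y) = 1 / real (Suc k + 1)" "1 / (1 + y) = real (k + 1) / real (k + 2)"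
    by (simp_all add: y_def field_simps)
  have "(farey_distr ^^ Suc n) V y = (farey_distr ^^ n) V (1 / real (Suc k + 1)) +
       (V 1 - (farey_distr ^^ n) V (real (k + 1) / real (k + 2)))"
    unfolding farey_distr_funpow_Suc y farey_distr_funpow_at_1 by simp
  then show ?case
    unfolding Suc.IH sum.lessThan_Suc_shift y_def by (simp add: algebra_simps)
qed simp

lemma sum_ln_telescope: "(\<Sum>i<n. ln (real (i + 2) / real (i + 1))) = ln (real (n + 1))"
  by (induction n) (simp_all add: ln_div add.commute)

text \<open>The increment is the integral of u(x)/x over an interval inside [1/2, 1], where u lies
  between its values at 1/2 and 1. Comparison with multiples of ln replaces the integration.\<close>

lemma farey_distr_increment_bounds:
  assumes "inc_concave f" "\<And>x. x > 0 \<Longrightarrow> (V has_real_derivative f x / x) (at x)"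
  shows "(farey_op ^^ n) f (1/2) * ln (real (i + 2) / real (i + 1))
       \<le> V 1 - (farey_distr ^^ n) V (real (i + 1) / real (i + 2))" (is ?A)
    and "V 1 - (farey_distr ^^ n) V (real (i + 1) / real (i + 2))
       \<le> (farey_op ^^ n) f 1 * ln (real (i + 2) / real (i + 1))" (is ?B)
proof -
  let ?W = "(farey_distr ^^ n) V" and ?u = "(farey_op ^^ n) f"
  define y where "y = real (i + 1) / real (i + 2)"
  have y: "1/2 \<le> y" "y \<le> 1" by (simp_all add: y_def field_simps)
  have lny: "ln (real (i + 2) / real (i + 1)) = - ln y"
    by (simp add: y_def ln_div)
  have W: "(?W has_real_derivative ?u x / x) (at x)" if "x > 0" for x
    by (rule farey_distr_deriv[OF assms(2) that])
  note mono = inc_concave_mono[OF inc_concave_farey_op_funpow[OF assms(1)]]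
  have "?W y - ?u (1/2) * ln y \<le> ?W 1 - ?u (1/2) * ln 1"
  proof (rule DERIV_nonneg_imp_nondecreasing[OF y(2)])
    fix z assume z: "y \<le> z" "z \<le> 1"
    have "((\<lambda>x. ?W x - ?u (1/2) * ln x) has_real_derivative ?u z / z - ?u (1/2) * (1 / z)) (at z)"
      using y z by (auto intro!: derivative_eq_intros W)
    moreover have "?u z / z - ?u (1/2) * (1 / z) \<ge> 0"
      using mono[of "1/2" z n] y z by (simp add: divide_right_mono)
    ultimately show "\<exists>d. ((\<lambda>x. ?W x - ?u (1/2) * ln x) has_real_derivative d) (at z) \<and> 0 \<le> d" by blast
  qed
  then show ?A unfolding lny y_def[symmetric] by (simp add: farey_distr_funpow_at_1)
  have "?W y - ?u 1 * ln y \<ge> ?W 1 - ?u 1 * ln 1"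
  proof (rule DERIV_nonpos_imp_nonincreasing[OF y(2)])
    fix z assume z: "y \<le> z" "z \<le> 1"
    have "((\<lambda>x. ?W x - ?u 1 * ln x) has_real_derivative ?u z / z - ?u 1 * (1 / z)) (at z)"
      using y z by (auto intro!: derivative_eq_intros W)
    moreover have "?u z / z - ?u 1 * (1 / z) \<le> 0"
      using mono[of z 1 n] y z by (simp add: divide_right_mono)
    ultimately show "\<exists>d. ((\<lambda>x. ?W x - ?u 1 * ln x) has_real_derivative d) (at z) \<and> d \<le> 0" by blast
  qed
  then show ?B unfolding lny y_def[symmetric] by (simp add: farey_distr_funpow_at_1)
qed

lemma inc_concave_nonneg: "inc_concave f \<Longrightarrow> 0 < x \<Longrightarrow> x \<le> 1 \<Longrightarrow> f x \<ge> 0"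
  unfolding inc_concave_def by auto

lemma farey_op_funpow_antimono:
  assumes "inc_concave f" "x \<in> {1/2..1}" "m \<le> n"
  shows "(farey_op ^^ n) f x \<le> (farey_op ^^ m) f x"
proof -
  have "decseq (\<lambda>n. (farey_op ^^ n) f x)"
    using farey_op_le_of_inc_concave[OF inc_concave_farey_op_funpow[OF assms(1)] assms(2)]
    by (simp add: decseq_Suc_iff)
  then show ?thesis using assms(3) by (auto simp: decseq_def)
qed

text \<open>\<open>V0\<close> normalizes the antiderivative at 0, so that \<open>V 1\<close> is the
  total mass of f.\<close>

lemma inc_concave_asymp:
  assumes f: "inc_concave f" and V: "\<And>x. x > 0 \<Longrightarrow> (V has_real_derivative f x / x) (at x)"
    and V0: "(\<lambda>n. V (1 / real (n + 1))) \<longlonglongrightarrow> 0" and x: "x \<in> {1/2..1}"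
  shows "(\<lambda>n. ln (real n) * (farey_op ^^ n) f x) \<longlonglongrightarrow> V 1"
proof -
  define u where "u n = (farey_op ^^ n) f (1/2)" for n
  define w where "w n = (farey_op ^^ n) f 1" for n
  have wu: "w (Suc n) = u n" for n unfolding u_def w_def by (rule farey_op_funpow_at_1)
  have u0: "u n \<ge> 0" and w0: "w n \<ge> 0" for n
    unfolding u_def w_def using inc_concave_nonneg[OF inc_concave_farey_op_funpow[OF f]] by auto
  have uanti: "u n \<le> u m" and wanti: "w n \<le> w m" if "m \<le> n" for m n
    unfolding u_def w_def using that by (auto intro!: farey_op_funpow_antimono f)
  define D where "D n i = V 1 - (farey_distr ^^ n) V (real (i + 1) / real (i + 2))" for n i
  define l where "l i = ln (real (i + 2) / real (i + 1))" for i
  have l0: "l i \<ge> 0" for i unfolding l_def by (intro ln_ge_zero) (simp add: field_simps)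
  have Dlo: "u n * l i \<le> D n i" and Dhi: "D n i \<le> w n * l i" for n i
    unfolding u_def w_def D_def l_def using farey_distr_increment_bounds[OF f V] by blast+
  have ren: "(\<Sum>i<n. D (n - 1 - i) i) = V 1 - V (1 / real (n + 1))" for n
    using farey_distr_renewal[of n V 0] by (simp add: D_def farey_distr_funpow_at_1)
  have suml: "(\<Sum>i<n. l i) = ln (real (n + 1))" for n
    unfolding l_def by (rule sum_ln_telescope)
  \<comment> \<open>Each \<open>u (n - 1 - i)\<close> is at least \<open>u n\<close>, and the
    weights \<open>l i\<close> add up to ln (n + 1).\<close>
  have up: "u n * ln (real (n + 1)) \<le> V 1 - V (1 / real (n + 1))" for n
  proof -
    have "u n * ln (real (n + 1)) = (\<Sum>i<n. u n * l i)" by (simp add: suml sum_distrib_left[symmetric])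
    also have "\<dots> \<le> (\<Sum>i<n. D (n - 1 - i) i)"
      by (intro sum_mono order_trans[OF _ Dlo] mult_right_mono uanti l0) auto
    finally show ?thesis unfolding ren .
  qed
  have u_lim0: "u \<longlonglongrightarrow> 0"
  proof (rule tendsto_sandwich[of "\<lambda>_. 0" _ _ "\<lambda>n. (V 1 - V (1 / real (n + 1))) / ln (real (n + 1))"])
    show "\<forall>\<^sub>F n in sequentially. u n \<le> (V 1 - V (1 / real (n + 1))) / ln (real (n + 1))"
      using eventually_gt_at_top[of 0] by eventually_elim (use up in \<open>simp add: field_simps\<close>)
    have "filterlim (\<lambda>n. ln (real (n + 1))) at_top sequentially" by real_asymp
    moreover have "(\<lambda>n. V 1 - V (1 / real (n + 1))) \<longlonglongrightarrow> V 1 - 0" by (intro tendsto_intros V0)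
    ultimately show "(\<lambda>n. (V 1 - V (1 / real (n + 1))) / ln (real (n + 1))) \<longlonglongrightarrow> 0"
      by (rule real_tendsto_divide_at_top[rotated])
  qed (use u0 in auto)
  have w_lim0: "w \<longlonglongrightarrow> 0"
    by (rule LIMSEQ_imp_Suc) (use u_lim0 in \<open>simp add: wu\<close>)
  define c where "c r = (\<Sum>j<r. w j) / real r" for r
  have c0: "c \<longlonglongrightarrow> 0" unfolding c_def using cesaro_tendsto_0[OF w_lim0 w0] .
  text \<open>Run the renewal equation up to time \<open>2r\<close>: excursions shorter than \<open>r\<close> start after time \<open>r\<close>,
    and the longer ones contribute only a Cesaro mean of \<open>w\<close>.\<close>
  have lo: "V 1 - V (1 / real (2 * r + 1)) - c r \<le> w r * ln (real (r + 1))" if r: "r > 0" for r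
  proof -
    have "V 1 - V (1 / real (2 * r + 1)) = (\<Sum>i<2 * r. D (2 * r - 1 - i) i)" using ren[of "2*r"] by simp
    also have "\<dots> = (\<Sum>i<r. D (2 * r - 1 - i) i) + (\<Sum>i=r..<2*r. D (2 * r - 1 - i) i)"
      by (simp add: lessThan_atLeast0 sum.atLeastLessThan_concat)
    also have "(\<Sum>i<r. D (2 * r - 1 - i) i) \<le> (\<Sum>i<r. w r * l i)"
      by (intro sum_mono order_trans[OF Dhi] mult_right_mono wanti l0) auto
    also have "\<dots> = w r * ln (real (r + 1))" by (simp add: suml sum_distrib_left[symmetric])
    also have "(\<Sum>i=r..<2*r. D (2 * r - 1 - i) i) \<le> (\<Sum>i=r..<2*r. w (2 * r - 1 - i) * (1 / real r))"
    proof (intro sum_mono order_trans[OF Dhi] mult_left_mono w0)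
      fix i assume i: "i \<in> {r..<2*r}"
      have "l i \<le> real (i + 2) / real (i + 1) - 1" unfolding l_def by (intro ln_le_minus_one) simp
      also have "\<dots> = 1 / real (i + 1)" by (simp add: field_simps)
      also have "\<dots> \<le> 1 / real r" using i r by (intro divide_left_mono) auto
      finally show "l i \<le> 1 / real r" .
    qed
    also have "(\<Sum>i=r..<2*r. w (2 * r - 1 - i) * (1 / real r)) = c r"
      unfolding c_def sum_divide_distrib
      by (rule sum.reindex_bij_witness[of _ "\<lambda>j. 2 * r - 1 - j" "\<lambda>i. 2 * r - 1 - i"]) auto
    finally show ?thesis by simp
  qed
  have V2: "(\<lambda>r. V (1 / real (2 * r + 1))) \<longlonglongrightarrow> 0"
    using filterlim_compose[OF V0, of "\<lambda>r. 2 * r"] by (simp add: filterlim_subseq strict_mono_def)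
  text \<open>The two bounds meet because \<open>w (Suc n) = u n\<close>.\<close>
  have u_lim: "(\<lambda>n. u n * ln (real n)) \<longlonglongrightarrow> V 1"
  proof (rule tendsto_sandwich[where h = "\<lambda>n. V 1 - V (1 / real (n + 1))" and
        f = "\<lambda>n. (V 1 - V (1 / real (2 * Suc n + 1)) - c (Suc n)) * (ln (real n) / ln (real (n + 2)))"])
    show "\<forall>\<^sub>F n in sequentially. u n * ln (real n) \<le> V 1 - V (1 / real (n + 1))"
      using eventually_gt_at_top[of 0]
    proof eventually_elim
      case (elim n)
      then have "u n * ln (real n) \<le> u n * ln (real (n + 1))" by (intro mult_left_mono u0) auto
      then show ?case using up[of n] by linarith
    qed
    show "(\<lambda>n. V 1 - V (1 / real (n + 1))) \<longlonglongrightarrow> V 1" using tendsto_diff[OF tendsto_const V0, of "V 1"] by simp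
    show "\<forall>\<^sub>F n in sequentially. (V 1 - V (1 / real (2 * Suc n + 1)) - c (Suc n)) * (ln (real n) / ln (real (n + 2)))
       \<le> u n * ln (real n)"
      using eventually_gt_at_top[of 1]
    proof eventually_elim
      case (elim n)
      \<comment> \<open>The bound \<open>lo\<close> at r = n + 1 speaks of \<open>w (Suc n)\<close>,
        that is \<open>u n\<close>, and of ln (n + 2). The quotient of logarithms tends to 1 and
        restores ln n.\<close>
      have "V 1 - V (1 / real (2 * Suc n + 1)) - c (Suc n) \<le> u n * ln (real (n + 2))"
        using lo[of "Suc n"] by (simp add: wu)
      moreover have "ln (real n) / ln (real (n + 2)) \<ge> 0" using elim by simp
      ultimately have "(V 1 - V (1 / real (2 * Suc n + 1)) - c (Suc n)) * (ln (real n) / ln (real (n + 2)))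
        \<le> u n * ln (real (n + 2)) * (ln (real n) / ln (real (n + 2)))"
        by (intro mult_right_mono)
      also have "\<dots> = u n * ln (real n)" using elim by simp
      finally show ?case .
    qed
    have r: "(\<lambda>n. ln (real n) / ln (real (n + 2))) \<longlonglongrightarrow> 1" by real_asymp
    have "(\<lambda>n. (V 1 - V (1 / real (2 * Suc n + 1)) - c (Suc n)) * (ln (real n) / ln (real (n + 2))))
       \<longlonglongrightarrow> (V 1 - 0 - 0) * 1"
      by (intro tendsto_mult tendsto_diff tendsto_const r LIMSEQ_Suc[OF V2] LIMSEQ_Suc[OF c0])
    then show "(\<lambda>n. (V 1 - V (1 / real (2 * Suc n + 1)) - c (Suc n)) * (ln (real n) / ln (real (n + 2))))
       \<longlonglongrightarrow> V 1" by simp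
  qed
  have "(\<lambda>n. w (Suc n) * ln (real (Suc n))) \<longlonglongrightarrow> V 1"
  proof -
    have r: "(\<lambda>n. ln (real (Suc n)) / ln (real n)) \<longlonglongrightarrow> 1" by real_asymp
    have "(\<lambda>n. u n * ln (real n) * (ln (real (Suc n)) / ln (real n))) \<longlonglongrightarrow> V 1 * 1"
      by (intro tendsto_mult u_lim r)
    moreover have "\<forall>\<^sub>F n in sequentially. u n * ln (real n) * (ln (real (Suc n)) / ln (real n)) = w (Suc n) * ln (real (Suc n))"
      using eventually_gt_at_top[of 1] by eventually_elim (simp add: wu)
    ultimately have "(\<lambda>n. w (Suc n) * ln (real (Suc n))) \<longlonglongrightarrow> V 1 * 1"
      by (rule Lim_transform_eventually)
    then show ?thesis by simp
  qed
  then have w_lim: "(\<lambda>n. w n * ln (real n)) \<longlonglongrightarrow> V 1" by (rule LIMSEQ_imp_Suc)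
  have between: "u n \<le> (farey_op ^^ n) f x" "(farey_op ^^ n) f x \<le> w n" for n
    unfolding u_def w_def using x by (auto intro!: inc_concave_mono[OF inc_concave_farey_op_funpow[OF f]])
  show ?thesis
    by (rule tendsto_sandwich[OF _ _ u_lim w_lim])
      (use between in \<open>auto intro!: eventually_sequentiallyI[of 1] mult_right_mono simp: mult.commute[of "ln _"]\<close>)
qed

section \<open>Integration with respect to the invariant measure\<close>

lemma sets_mu1 [simp, measurable_cong]: "sets mu1 = sets lebesgue"
  by (simp add: mu1_def)

lemma borel_measurable_mu1: "borel_measurable mu1 = borel_measurable lebesgue"
  by (rule measurable_cong_sets) auto

lemma mu1_density_measurable: "(\<lambda>x. indicator {0..1} x * h1 x) \<in> borel_measurable lebesgue"
  unfolding h1_def by (intro measurable_completion) measurable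

lemma mu1_density_nonneg: "0 \<le> indicator {0..1} x * h1 x"
  by (simp add: h1_def indicator_def)

lemma integrable_mu1_iff:
  fixes g :: "real \<Rightarrow> 'a::{banach,second_countable_topology}"
  assumes "g \<in> borel_measurable lebesgue"
  shows "integrable mu1 g \<longleftrightarrow> integrable lebesgue (\<lambda>x. (indicator {0..1} x * h1 x) *\<^sub>R g x)"
  unfolding mu1_def
  by (rule integrable_density[OF assms mu1_density_measurable]) (simp add: mu1_density_nonneg)

lemma integral_mu1:
  fixes g :: "real \<Rightarrow> 'a::{banach,second_countable_topology}"
  assumes "g \<in> borel_measurable lebesgue"
  shows "integral\<^sup>L mu1 g = (LINT x|lebesgue. (indicator {0..1} x * h1 x) *\<^sub>R g x)"
  unfolding mu1_def
  by (rule integral_density[OF assms mu1_density_measurable]) (simp add: mu1_density_nonneg)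

lemma AE_mu1: "AE x in mu1. 0 < x \<and> x \<le> 1"
  unfolding mu1_def
  by (subst AE_density)
    (use mu1_density_measurable in \<open>auto simp: h1_def indicator_def intro!: AE_I2\<close>)

text \<open>The factor x cancels the density 1/x away from the null point 0.\<close>

lemma mu1_continuous:
  fixes \<phi> :: "real \<Rightarrow> real"
  assumes "continuous_on UNIV \<phi>"
  shows "integrable mu1 (\<lambda>x. x * \<phi> x)" "integral\<^sup>L mu1 (\<lambda>x. x * \<phi> x) = integral {0..1} \<phi>"
proof -
  have m: "(\<lambda>x. x * \<phi> x) \<in> borel_measurable lebesgue" "\<phi> \<in> borel_measurable lebesgue"
    using borel_measurable_continuous_onI[OF assms] by (auto intro!: measurable_completion)
  have ai: "\<phi> absolutely_integrable_on {0..1}"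
    by (intro absolutely_integrable_continuous_real continuous_on_subset[OF assms]) auto
  have ae: "AE x in lebesgue. (indicator {0..1} x * h1 x) *\<^sub>R (x * \<phi> x) = indicator {0..1} x *\<^sub>R \<phi> x"
  proof -
    have "AE x in lebesgue. x \<noteq> (0::real)"
      by (rule AE_completion) (rule AE_lborel_singleton)
    then show ?thesis by eventually_elim (auto simp: h1_def)
  qed
  have mm: "(\<lambda>x. (indicator {0..1} x * h1 x) *\<^sub>R (x * \<phi> x)) \<in> borel_measurable lebesgue"
    "(\<lambda>x. indicator {0..1} x *\<^sub>R \<phi> x) \<in> borel_measurable lebesgue"
    by (rule borel_measurable_scaleR[OF mu1_density_measurable m(1)])
      (rule borel_measurable_scaleR[OF borel_measurable_indicator m(2)], simp)
  show "integrable mu1 (\<lambda>x. x * \<phi> x)"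
    unfolding integrable_mu1_iff[OF m(1)] integrable_cong_AE[OF mm ae]
    using ai by (simp add: set_integrable_def)
  have "integral\<^sup>L mu1 (\<lambda>x. x * \<phi> x) = (LINT x:{0..1}|lebesgue. \<phi> x)"
    unfolding integral_mu1[OF m(1)] integral_cong_AE[OF mm ae] by (simp add: set_lebesgue_integral_def)
  also have "\<dots> = integral {0..1} \<phi>" by (rule set_lebesgue_integral_eq_integral(2)[OF ai])
  finally show "integral\<^sup>L mu1 (\<lambda>x. x * \<phi> x) = integral {0..1} \<phi>" .
qed

text \<open>The density is at most 1/a on [a, b].\<close>

lemma mu1_interval:
  assumes "0 < a" "a \<le> b" "S \<in> sets borel" "S \<subseteq> {a..b}"
  shows "integrable mu1 (indicator S :: real \<Rightarrow> real)" "integral\<^sup>L mu1 (indicator S) \<le> (b - a) / a"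
proof -
  have m: "(indicator S :: real \<Rightarrow> real) \<in> borel_measurable lebesgue"
    using assms by (intro measurable_completion) auto
  have i: "integrable lebesgue (\<lambda>x. (1 / a) * indicator {a..b} x)"
    by (intro integrable_mult_right integrable_completion[THEN iffD2])
      (auto intro!: integrable_real_indicator simp: emeasure_lborel_Icc_eq)
  have le: "(indicator {0..1} x * h1 x) *\<^sub>R indicator S x \<le> (1 / a) * indicator {a..b} x" for x
    using assms by (auto simp: h1_def indicator_def divide_left_mono)
  have bnd: "norm ((indicator {0..1} x * h1 x) *\<^sub>R (indicator S x :: real)) \<le> norm ((1 / a) * indicator {a..b} x)" for x
    using assms by (auto simp: h1_def indicator_def divide_left_mono)
  have i2: "integrable lebesgue (\<lambda>x. (indicator {0..1} x * h1 x) *\<^sub>R (indicator S x :: real))"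
    by (rule Bochner_Integration.integrable_bound[OF i borel_measurable_scaleR[OF mu1_density_measurable m]
      AE_I2[OF bnd]])
  then show "integrable mu1 (indicator S :: real \<Rightarrow> real)" using integrable_mu1_iff[OF m] by simp
  have "integral\<^sup>L mu1 (indicator S) \<le> (LINT x|lebesgue. (1 / a) * indicator {a..b} x)"
    unfolding integral_mu1[OF m] by (intro integral_mono i i2 le)
  also have "\<dots> = (b - a) / a" using assms by simp
  finally show "integral\<^sup>L mu1 (indicator S) \<le> (b - a) / a" .
qed

section \<open>Closure properties of the class of functions with logarithmic asymptotics\<close>

text \<open>The desired conclusion as a predicate, bundled with integrability so that the limit is
  linear and stable under approximation.\<close>

definition farey_asymp :: "(real \<Rightarrow> 'a::{banach,second_countable_topology}) \<Rightarrow> bool" where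
  "farey_asymp g \<longleftrightarrow> integrable mu1 g \<and>
     (\<forall>x\<in>Y. (\<lambda>n. ln (real n) *\<^sub>R (farey_op ^^ n) g x) \<longlonglongrightarrow> integral\<^sup>L mu1 g)"

lemma farey_asymp_add:
  assumes "farey_asymp f" "farey_asymp g"
  shows "farey_asymp (\<lambda>x. f x + g x)"
  using assms unfolding farey_asymp_def farey_op_funpow_add
  by (auto simp: scaleR_add_right intro!: tendsto_add)

text \<open>A bounded linear map commutes with the operator, the limit and the integral.\<close>

lemma farey_asymp_bounded_linear:
  assumes "bounded_linear L" "farey_asymp g"
  shows "farey_asymp (\<lambda>x. L (g x))"
proof -
  have "integrable mu1 (\<lambda>x. L (g x))" "integral\<^sup>L mu1 (\<lambda>x. L (g x)) = L (integral\<^sup>L mu1 g)"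
    using assms by (auto simp: farey_asymp_def integrable_bounded_linear integral_bounded_linear)
  moreover have "(\<lambda>n. L (ln (real n) *\<^sub>R (farey_op ^^ n) g x)) \<longlonglongrightarrow> L (integral\<^sup>L mu1 g)" if "x \<in> Y" for x
    using assms that by (intro bounded_linear.tendsto[OF assms(1)]) (auto simp: farey_asymp_def)
  ultimately show ?thesis
    unfolding farey_asymp_def farey_op_funpow_linear[OF bounded_linear.linear[OF assms(1)]]
    by (simp add: linear_scale[OF bounded_linear.linear[OF assms(1)]])
qed

lemma farey_asymp_scaleR_left: "farey_asymp g \<Longrightarrow> farey_asymp (\<lambda>x. g x *\<^sub>R c)"
  by (rule farey_asymp_bounded_linear[OF bounded_linear_scaleR_left])

lemma farey_asymp_mult_left: "farey_asymp g \<Longrightarrow> farey_asymp (\<lambda>x. c * g x :: real)"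
  by (rule farey_asymp_bounded_linear[OF bounded_linear_mult_right])

lemma farey_asymp_diff:
  assumes "farey_asymp f" "farey_asymp g"
  shows "farey_asymp (\<lambda>x. f x - g x)"
  using farey_asymp_add[OF assms(1) farey_asymp_bounded_linear[OF bounded_linear_minus[OF bounded_linear_ident] assms(2)]]
  by simp

lemma farey_asymp_zero: "farey_asymp (\<lambda>x. 0::'a::{banach,second_countable_topology})"
proof -
  have "(farey_op ^^ n) (\<lambda>x. 0::'a) = (\<lambda>x. 0)" for n
    using farey_op_funpow_sum[of n "\<lambda>_ _. 0::'a" "{}"] by simp
  then show ?thesis by (simp add: farey_asymp_def)
qed

lemma farey_asymp_sum:
  assumes "\<And>i. i \<in> I \<Longrightarrow> farey_asymp (f i)"
  shows "farey_asymp (\<lambda>x. \<Sum>i\<in>I. f i x)"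
  using assms
  by (induction I rule: infinite_finite_induct) (auto intro: farey_asymp_add farey_asymp_zero)

text \<open>By positivity the iterates of g - s are bounded by those of e, which after scaling by ln
  n converge to the small number \<integral> e. The integrals of g and s also differ by at most
  \<integral> e.\<close>

lemma farey_asymp_sandwich:
  fixes g :: "real \<Rightarrow> 'a::{banach,second_countable_topology}"
  assumes int: "integrable mu1 g"
    and ap: "\<And>\<epsilon>. \<epsilon> > 0 \<Longrightarrow> \<exists>s e. farey_asymp s \<and> farey_asymp e \<and>
       (\<forall>y\<in>{0<..1}. norm (g y - s y) \<le> e y) \<and> integral\<^sup>L mu1 e \<le> \<epsilon>"
  shows "farey_asymp g"
  unfolding farey_asymp_def
proof (intro conjI ballI int LIMSEQ_I)
  fix x r :: real assume x: "x \<in> Y" and r: "r > 0"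
  obtain s e where s: "farey_asymp s" and e: "farey_asymp e"
    and le: "\<And>y. 0 < y \<Longrightarrow> y \<le> 1 \<Longrightarrow> norm (g y - s y) \<le> e y" and Ie: "integral\<^sup>L mu1 e \<le> r / 4"
    using ap[of "r / 4"] r by auto
  have "\<forall>\<^sub>F n in sequentially. ln (real n) *\<^sub>R (farey_op ^^ n) e x < 2 * (r / 4)"
    using e x Ie r by (intro order_tendstoD(2)) (auto simp: farey_asymp_def)
  moreover have "\<forall>\<^sub>F n in sequentially. dist (ln (real n) *\<^sub>R (farey_op ^^ n) s x) (integral\<^sup>L mu1 s) < r / 4"
    using s x r by (intro tendstoD) (auto simp: farey_asymp_def)
  moreover have "\<forall>\<^sub>F n in sequentially. n \<ge> (1::nat)" by (rule eventually_ge_at_top)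
  ultimately have "\<forall>\<^sub>F n in sequentially. norm (ln (real n) *\<^sub>R (farey_op ^^ n) g x - integral\<^sup>L mu1 g) < r"
  proof eventually_elim
    case (elim n)
    have ints: "integrable mu1 s" and ie: "integrable mu1 e" using s e by (auto simp: farey_asymp_def)
    have "norm (integral\<^sup>L mu1 s - integral\<^sup>L mu1 g) = norm (integral\<^sup>L mu1 (\<lambda>x. g x - s x))"
      using ints int by (simp add: norm_minus_commute)
    also have "\<dots> \<le> integral\<^sup>L mu1 (\<lambda>x. norm (g x - s x))" by (rule integral_norm_bound)
    also have "\<dots> \<le> integral\<^sup>L mu1 e"
      using ints int ie eventually_mono[OF AE_mu1, of "\<lambda>x. norm (g x - s x) \<le> e x"] le
      by (intro integral_mono_AE) auto
    finally have 1: "norm (integral\<^sup>L mu1 s - integral\<^sup>L mu1 g) \<le> r / 4" using Ie by simp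
    have "(farey_op ^^ n) (\<lambda>y. s y + (g y - s y)) x = (farey_op ^^ n) s x + (farey_op ^^ n) (\<lambda>y. g y - s y) x"
      by (simp only: farey_op_funpow_add)
    then have dec: "(farey_op ^^ n) g x = (farey_op ^^ n) s x + (farey_op ^^ n) (\<lambda>y. g y - s y) x" by simp
    have "norm ((farey_op ^^ n) (\<lambda>y. g y - s y) x) \<le> (farey_op ^^ n) e x"
      using x by (intro farey_op_funpow_norm_le le) (auto simp: Y_def)
    then have "norm (ln (real n) *\<^sub>R (farey_op ^^ n) (\<lambda>y. g y - s y) x) \<le> ln (real n) *\<^sub>R (farey_op ^^ n) e x"
      using elim(3) by (auto intro!: mult_left_mono)
    then have 2: "norm (ln (real n) *\<^sub>R (farey_op ^^ n) (\<lambda>y. g y - s y) x) < r / 2" using elim(1) by linarith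
    have 3: "norm (ln (real n) *\<^sub>R (farey_op ^^ n) s x - integral\<^sup>L mu1 s) < r / 4"
      using elim(2) by (simp add: dist_norm)
    have "ln (real n) *\<^sub>R (farey_op ^^ n) g x - integral\<^sup>L mu1 g =
      ln (real n) *\<^sub>R (farey_op ^^ n) (\<lambda>y. g y - s y) x +
      ((ln (real n) *\<^sub>R (farey_op ^^ n) s x - integral\<^sup>L mu1 s) + (integral\<^sup>L mu1 s - integral\<^sup>L mu1 g))"
      unfolding dec by (simp add: algebra_simps)
    also have "norm \<dots> \<le> norm (ln (real n) *\<^sub>R (farey_op ^^ n) (\<lambda>y. g y - s y) x) +
      (norm (ln (real n) *\<^sub>R (farey_op ^^ n) s x - integral\<^sup>L mu1 s) +
        norm (integral\<^sup>L mu1 s - integral\<^sup>L mu1 g))"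
      by (intro norm_triangle_le add_left_mono norm_triangle_ineq)
    also have "\<dots> < r" using 1 2 3 by linarith
    finally show ?case .
  qed
  then show "\<exists>no. \<forall>n\<ge>no. norm (ln (real n) *\<^sub>R (farey_op ^^ n) g x - integral\<^sup>L mu1 g) < r"
    by (simp add: eventually_sequentially)
qed

section \<open>From increasing concave functions to functions of bounded variation\<close>

text \<open>An antiderivative of \<phi> has derivative u(x)/x for u(x) = x \<phi>(x), and its
  continuity at 0 supplies the normalization.\<close>

lemma farey_asymp_inc_concave:
  assumes "inc_concave (\<lambda>x. x * \<phi> x)" "\<And>x. (V has_real_derivative \<phi> x) (at x)" "V 0 = 0"
    "continuous_on UNIV \<phi>"
  shows "farey_asymp (\<lambda>x. x * \<phi> x)"
proof -
  have "(\<phi> has_integral V 1 - V 0) {0..1}"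
    by (rule fundamental_theorem_of_calculus)
      (auto intro: has_vector_derivative_at_within assms(2)[unfolded has_real_derivative_iff_has_vector_derivative])
  then have I: "integral {0..1} \<phi> = V 1" using assms(3) by (simp add: integral_unique)
  have "isCont V 0" using assms(2) by (rule DERIV_isCont)
  moreover have "(\<lambda>n. 1 / real (n + 1)) \<longlonglongrightarrow> 0" by real_asymp
  ultimately have V0: "(\<lambda>n. V (1 / real (n + 1))) \<longlonglongrightarrow> 0"
    using isCont_tendsto_compose[of 0 V] assms(3) by fastforce
  show ?thesis
    unfolding farey_asymp_def mu1_continuous(2)[OF assms(4)] I real_scaleR_def
    by (intro conjI ballI mu1_continuous(1)[OF assms(4)] inc_concave_asymp[OF assms(1) _ V0])
      (use assms(2) in \<open>auto simp: Y_def\<close>)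
qed

text \<open>Every function \<open>x * \<phi> x\<close> with smooth \<open>\<phi>\<close> becomes increasing and concave after adding a
  large multiple of \<open>3 * x - x\<^sup>2\<close>.\<close>

lemma farey_asymp_power: "farey_asymp (\<lambda>x::real. x * x ^ k)"
proof -
  \<comment> \<open>The second derivative of x^(k+1) is at most C on (0, 1], while that of C x (3 -
    x) is -2 C.\<close>
  define C where "C = real (k * (k + 1))"
  have C: "C \<ge> 0" by (simp add: C_def)
  have 1: "farey_asymp (\<lambda>x. x * (C * (3 - x)))"
  proof (rule farey_asymp_inc_concave[where V = "\<lambda>x. C * (3 * x - x^2 / 2)"])
    show "inc_concave (\<lambda>x. x * (C * (3 - x)))"
      unfolding inc_concave_def
    proof (rule exI[of _ "\<lambda>x. C * (3 - 2 * x)"], rule exI[of _ "\<lambda>x. - 2 * C"], intro conjI allI impI ballI)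
      fix x :: real assume x: "x \<in> {0<..1}"
      show "0 \<le> x * (C * (3 - x))" "0 \<le> C * (3 - 2 * x)" "- 2 * C \<le> 0" using x C by auto
    qed (auto intro!: derivative_eq_intros simp: algebra_simps)
  qed (auto intro!: derivative_eq_intros continuous_intros simp: algebra_simps)
  have 2: "farey_asymp (\<lambda>x. x * (C * (3 - x) + x ^ k))"
  proof (rule farey_asymp_inc_concave[where V = "\<lambda>x. C * (3 * x - x^2 / 2) + x^(k + 1) / real (k + 1)"])
    show "inc_concave (\<lambda>x. x * (C * (3 - x) + x ^ k))"
      unfolding inc_concave_def
    \<comment> \<open>For k = 0 the truncated exponent \<open>k - 1\<close> is harmless because its
      coefficient vanishes.\<close>
    proof (rule exI[of _ "\<lambda>x. C * (3 - 2 * x) + real (k + 1) * x ^ k"],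
        rule exI[of _ "\<lambda>x. - 2 * C + real (k + 1) * (real k * x ^ (k - 1))"],
        intro conjI allI impI ballI)
      fix x :: real assume x: "x > 0"
      have "((\<lambda>x. C * (x * (3 - x)) + x ^ (Suc k)) has_real_derivative 
          C * (3 - 2 * x) + real (k + 1) * x ^ k) (at x)"
        by (rule DERIV_cong[OF DERIV_add[OF DERIV_cmult[OF DERIV_mult[OF DERIV_ident DERIV_diff[OF DERIV_const DERIV_ident]]] DERIV_pow]])
          (simp add: algebra_simps)
      then show "((\<lambda>x. x * (C * (3 - x) + x ^ k)) has_real_derivative 
          C * (3 - 2 * x) + real (k + 1) * x ^ k) (at x)" by (simp add: algebra_simps)
      show "((\<lambda>x. C * (3 - 2 * x) + real (k + 1) * x ^ k) has_real_derivative
          - 2 * C + real (k + 1) * (real k * x ^ (k - 1))) (at x)"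
        by (auto intro!: derivative_eq_intros simp: algebra_simps)
    next
      fix x :: real assume x: "x \<in> {0<..1}"
      show "0 \<le> x * (C * (3 - x) + x ^ k)" using x C by (intro mult_nonneg_nonneg add_nonneg_nonneg) auto
      show "0 \<le> C * (3 - 2 * x) + real (k + 1) * x ^ k"
        using x C by (intro mult_nonneg_nonneg add_nonneg_nonneg) auto
      have "x ^ (k - 1) \<le> 1" using x by (intro power_le_one) auto
      then have "real (k + 1) * (real k * x ^ (k - 1)) \<le> real (k + 1) * (real k * 1)"
        by (intro mult_left_mono) auto
      also have "\<dots> = C" by (simp add: C_def algebra_simps)
      finally show "- 2 * C + real (k + 1) * (real k * x ^ (k - 1)) \<le> 0" using C by linarith
    qed
    have "((\<lambda>x. x^(k + 1) / real (k + 1)) has_real_derivative x ^ k) (at x)" for x :: real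
      by (rule DERIV_cong[OF DERIV_cdivide[OF DERIV_pow]]) simp
    then show "((\<lambda>x. C * (3 * x - x^2 / 2) + x^(k + 1) / real (k + 1)) has_real_derivative
      C * (3 - x) + x ^ k) (at x)" for x
      by (intro DERIV_add) (auto intro!: derivative_eq_intros)
  qed (auto intro!: continuous_intros)
  show ?thesis using farey_asymp_diff[OF 2 1] by (simp add: algebra_simps)
qed

text \<open>Weierstrass approximation of \<phi> within \<epsilon> leaves the error majorant
  \<epsilon> x, whose integral is \<epsilon>.\<close>

lemma farey_asymp_continuous:
  fixes \<phi> :: "real \<Rightarrow> real"
  assumes "continuous_on UNIV \<phi>"
  shows "farey_asymp (\<lambda>x. x * \<phi> x)"
proof (rule farey_asymp_sandwich)
  show "integrable mu1 (\<lambda>x. x * \<phi> x)" by (rule mu1_continuous[OF assms])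
  fix \<epsilon> :: real assume e: "\<epsilon> > 0"
  obtain p where p: "real_polynomial_function p" "\<And>x. x \<in> {0..1} \<Longrightarrow> \<bar>\<phi> x - p x\<bar> < \<epsilon>"
    using Stone_Weierstrass_real_polynomial_function[OF compact_Icc continuous_on_subset[OF assms] e, of 0 1]
    by auto
  obtain a n where an: "p = (\<lambda>x. \<Sum>i\<le>n. a i * x ^ i)"
    using p(1) unfolding real_polynomial_function_iff_sum by blast
  have "farey_asymp (\<lambda>x. \<Sum>i\<le>n. a i * (x * x ^ i))"
    by (intro farey_asymp_sum farey_asymp_mult_left farey_asymp_power)
  then have "farey_asymp (\<lambda>x. x * p x)" by (simp add: an sum_distrib_left algebra_simps)
  moreover have "farey_asymp (\<lambda>x. x * \<epsilon>)"
    using farey_asymp_mult_left[OF farey_asymp_power[of 0], of \<epsilon>] by (simp add: mult.commute)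
  moreover have "norm (y * \<phi> y - y * p y) \<le> y * \<epsilon>" if "y \<in> {0<..1}" for y
    using p(2)[of y] that by (auto simp: abs_mult simp flip: right_diff_distrib)
  moreover have "integral\<^sup>L mu1 (\<lambda>x. x * \<epsilon>) = \<epsilon>"
    using mu1_continuous(2)[of "\<lambda>_. \<epsilon>"] by simp
  ultimately show "\<exists>s e. farey_asymp s \<and> farey_asymp e \<and>
     (\<forall>y\<in>{0<..1}. norm (y * \<phi> y - s y) \<le> e y) \<and> integral\<^sup>L mu1 e \<le> \<epsilon>"
    by (intro exI[of _ "\<lambda>x. x * p x"] exI[of _ "\<lambda>x. x * \<epsilon>"]) auto
qed

lemma farey_asymp_indicator:
  assumes a: "0 < a" "a \<le> 1"
  shows "farey_asymp (indicator {a<..1} :: real \<Rightarrow> real)"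
proof (rule farey_asymp_sandwich)
  show "integrable mu1 (indicator {a<..1} :: real \<Rightarrow> real)"
    using a by (intro mu1_interval(1)[of a 1]) auto
  fix \<epsilon> :: real assume e: "\<epsilon> > 0"
  \<comment> \<open>The first bound keeps the window [a - d, a + d] above a/2; the second makes its
    measure, at most 2d / (a/2), no larger than \<epsilon>.\<close>
  define d where "d = min (a / 2) (\<epsilon> * a / 4)"
  have d: "d > 0" "d \<le> a / 2" "4 * d / a \<le> \<epsilon>" using e a by (auto simp: d_def min_def field_simps)
  \<comment> \<open>After multiplication by y, \<phi> gives a ramp from 0 at a to 1 at a + d, and
    \<psi> dominates the error by a tent around a. Dividing by \<open>max y a\<close> instead of y
    keeps both continuous on the whole line.\<close>
  define \<phi> where "\<phi> y = max 0 (min 1 ((y - a) / d)) / max y a" for y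
  define \<psi> where "\<psi> y = max 0 (1 - \<bar>y - a\<bar> / d) / max y a" for y
  have c: "continuous_on UNIV \<phi>" "continuous_on UNIV \<psi>"
    unfolding \<phi>_def \<psi>_def using a d by (auto intro!: continuous_intros)
  have "norm (indicator {a<..1} y - y * \<phi> y) \<le> y * \<psi> y" if y: "y \<in> {0<..1}" for y
  proof (cases "y \<le> a")
    case True
    then have "\<phi> y = 0" "\<psi> y \<ge> 0" using a d by (auto simp: \<phi>_def \<psi>_def divide_nonpos_pos)
    then show ?thesis using True y by auto
  next
    case False
    then have "y * \<phi> y = min 1 ((y - a) / d)" "y * \<psi> y = max 0 (1 - (y - a) / d)"
      using a d by (auto simp: \<phi>_def \<psi>_def)
    then show ?thesis using False y by (auto simp: min_def max_def)
  qed
  moreover have "integral\<^sup>L mu1 (\<lambda>y. y * \<psi> y) \<le> \<epsilon>"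
  proof -
    have le: "y * \<psi> y \<le> indicator {a - d..a + d} y" for y
    proof (cases "y \<in> {a - d..a + d}")
      case True
      have "\<bar>y - a\<bar> / d \<ge> 0" using d by simp
      then have "max 0 (1 - \<bar>y - a\<bar> / d) \<le> 1" by simp
      moreover have "y / max y a \<le> 1" "y / max y a \<ge> 0" using True d a by (auto simp: max_def)
      ultimately have "(y / max y a) * max 0 (1 - \<bar>y - a\<bar> / d) \<le> 1 * 1" by (intro mult_mono) auto
      then show ?thesis using True by (simp add: \<psi>_def)
    next
      case False
      then have "d \<le> \<bar>y - a\<bar>" by auto
      then have "1 - \<bar>y - a\<bar> / d \<le> 0" using d by (simp add: field_simps)
      then show ?thesis using False by (simp add: \<psi>_def)
    qed
    have "integral\<^sup>L mu1 (\<lambda>y. y * \<psi> y) \<le> integral\<^sup>L mu1 (indicator {a - d..a + d})"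
      using a d by (intro integral_mono le mu1_continuous(1)[OF c(2)] mu1_interval(1)[of "a - d" "a + d"]) auto
    also have "\<dots> \<le> (a + d - (a - d)) / (a - d)"
      using a d by (intro mu1_interval(2)) auto
    also have "\<dots> \<le> (2 * d) / (a / 2)" using a d by (intro frac_le) auto
    finally show ?thesis using d(3) by simp
  qed
  ultimately show "\<exists>s e. farey_asymp s \<and> farey_asymp e \<and>
     (\<forall>y\<in>{0<..1}. norm (indicator {a<..1} y - s y :: real) \<le> e y) \<and> integral\<^sup>L mu1 e \<le> \<epsilon>"
    by (intro exI[of _ "\<lambda>x. x * \<phi> x"] exI[of _ "\<lambda>x. x * \<psi> x"])
      (auto intro!: farey_asymp_continuous c)
qed

text \<open>Step functions on N equal cells of [1/4, 1] approximate g. The error on a cell is at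
  most the increment of V, each cell has measure at most 3/N, and the increments telescope. Starting
  at 1/4 places a possible jump at 1/2 inside the range of the left-open cells.\<close>

lemma farey_asymp_bounded_variation:
  fixes g :: "real \<Rightarrow> 'a::{banach,second_countable_topology}" and V :: "real \<Rightarrow> real"
  assumes int: "integrable mu1 g"
    and zero: "\<And>x. 0 < x \<Longrightarrow> x \<le> 1 / 4 \<Longrightarrow> g x = 0"
    and V: "\<And>x y. 1 / 4 \<le> x \<Longrightarrow> x \<le> y \<Longrightarrow> y \<le> 1 \<Longrightarrow> norm (g y - g x) \<le> V y - V x"
  shows "farey_asymp g"
proof (rule farey_asymp_sandwich[OF int])
  fix \<epsilon> :: real assume e: "\<epsilon> > 0"
  obtain N :: nat where N: "real N > 3 * (V 1 - V (1/4)) / \<epsilon>" "N > 0"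
  proof -
    obtain M :: nat where "real M > 3 * (V 1 - V (1/4)) / \<epsilon>" using reals_Archimedean2 by blast
    then show ?thesis by (intro that[of "Suc M"]) auto
  qed
  define p where "p i = 1 / 4 + (3 / 4) * (real i / real N)" for i
  have p0: "p 0 = 1 / 4" and pN: "p N = 1" using N by (auto simp: p_def)
  have pm: "p i \<le> p (Suc i)" "p (Suc i) - p i = 3 / 4 / real N" for i
    using N by (auto simp: p_def divide_simps)
  have pge: "1 / 4 \<le> p i" for i using N by (simp add: p_def)
  have ple: "p i \<le> 1" if "i \<le> N" for i using that N by (simp add: p_def field_simps)
  define q :: "nat \<Rightarrow> real \<Rightarrow> real" where "q i y = indicator {p i<..p (Suc i)} y" for i y
  have q: "q i y = indicator {p i<..1} y - indicator {p (Suc i)<..1} y" if "i < N" for i y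
    using ple[of "Suc i"] pm[of i] that by (auto simp: q_def indicator_def)
  have q_asymp: "farey_asymp (q i)" if "i < N" for i
  proof -
    have "farey_asymp (\<lambda>y. indicator {p i<..1} y - indicator {p (Suc i)<..1} y :: real)"
      using that ple[of i] ple[of "Suc i"] pge[of i] pge[of "Suc i"]
      by (intro farey_asymp_diff farey_asymp_indicator) auto
    also have "(\<lambda>y. indicator {p i<..1} y - indicator {p (Suc i)<..1} y :: real) = q i"
      using q[OF that] by auto
    finally show ?thesis .
  qed
  have q_sum: "(\<Sum>i<N. q i y) = indicator {1/4<..1} y" for y
  proof -
    have "(\<Sum>i<N. q i y) = (\<Sum>i<N. indicator {p i<..1} y - indicator {p (Suc i)<..1} y)"
      by (intro sum.cong refl q) auto
    also have "\<dots> = indicator {p 0<..1} y - indicator {p N<..1} y" by (rule sum_lessThan_telescope')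
    finally show ?thesis by (simp add: p0 pN)
  qed
  define s where "s y = (\<Sum>i<N. q i y *\<^sub>R g (p (Suc i)))" for y
  define e where "e y = (\<Sum>i<N. (V (p (Suc i)) - V (p i)) * q i y)" for y
  have Vm: "V (p i) \<le> V (p (Suc i))" if "i < N" for i
    using V[of "p i" "p (Suc i)"] pge[of i] pm[of i] ple[of "Suc i"] that
    by (smt (verit) norm_ge_zero Suc_leI)
  have "farey_asymp s" unfolding s_def[abs_def]
    by (intro farey_asymp_sum farey_asymp_scaleR_left q_asymp) auto
  moreover have "farey_asymp e" unfolding e_def[abs_def]
    by (intro farey_asymp_sum farey_asymp_mult_left q_asymp) auto
  moreover have "norm (g y - s y) \<le> e y" if y: "y \<in> {0<..1}" for y
  proof -
    have "g y = (\<Sum>i<N. q i y) *\<^sub>R g y" unfolding q_sum using y zero[of y] by (auto simp: indicator_def)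
    then have "g y - s y = (\<Sum>i<N. q i y *\<^sub>R (g y - g (p (Suc i))))"
      by (simp add: s_def scaleR_sum_left sum_subtractf scaleR_diff_right)
    also have "norm \<dots> \<le> (\<Sum>i<N. norm (q i y *\<^sub>R (g y - g (p (Suc i)))))" by (rule norm_sum)
    also have "\<dots> \<le> e y" unfolding e_def
    proof (rule sum_mono)
      fix i assume "i \<in> {..<N}"
      then have i: "i < N" by simp
      show "norm (q i y *\<^sub>R (g y - g (p (Suc i)))) \<le> (V (p (Suc i)) - V (p i)) * q i y"
      proof (cases "y \<in> {p i<..p (Suc i)}")
        case True
        have "norm (g (p (Suc i)) - g y) \<le> V (p (Suc i)) - V y"
          using True pge[of i] ple[of "Suc i"] i by (intro V) auto
        moreover have "norm (g y - g (p i)) \<le> V y - V (p i)"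
          using True pge[of i] y by (intro V) auto
        then have "V (p i) \<le> V y" using norm_ge_zero[of "g y - g (p i)"] by linarith
        ultimately show ?thesis using True by (simp add: q_def norm_minus_commute)
      qed (simp add: q_def)
    qed
    finally show ?thesis .
  qed
  moreover have "integral\<^sup>L mu1 e \<le> \<epsilon>"
  proof -
    have iq: "integral\<^sup>L mu1 (q i) \<le> 3 / real N" if "i < N" for i
    proof -
      have "integral\<^sup>L mu1 (q i) \<le> (p (Suc i) - p i) / p i"
        unfolding q_def[abs_def] using pge[of i] pm[of i] by (intro mu1_interval(2)) auto
      also have "\<dots> \<le> (3 / 4 / real N) / (1 / 4)" unfolding pm(2) using pge[of i] N
        by (intro divide_left_mono) auto
      finally show ?thesis by simp
    qed
    have "integral\<^sup>L mu1 e = (\<Sum>i<N. (V (p (Suc i)) - V (p i)) * integral\<^sup>L mu1 (q i))"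
      unfolding e_def using q_asymp by (subst Bochner_Integration.integral_sum) (auto simp: farey_asymp_def)
    also have "\<dots> \<le> (\<Sum>i<N. (V (p (Suc i)) - V (p i)) * (3 / real N))"
      using Vm iq by (intro sum_mono mult_left_mono) auto
    also have "\<dots> = (V 1 - V (1/4)) * (3 / real N)"
      using sum_lessThan_telescope[of "\<lambda>i. V (p i)" N]
      by (simp only: sum_distrib_right[symmetric] pN p0)
    also have "\<dots> \<le> \<epsilon>" using N \<open>\<epsilon> > 0\<close> by (simp add: field_simps)
    finally show ?thesis .
  qed
  ultimately show "\<exists>s e. farey_asymp s \<and> farey_asymp e \<and>
     (\<forall>y\<in>{0<..1}. norm (g y - s y) \<le> e y) \<and> integral\<^sup>L mu1 e \<le> \<epsilon>" by blast
qed

text \<open>V is the total variation function on [0, x]: appending x and y to a partition that ends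
  at or before x gives one for [0, y] whose sum is larger by at least the norm of g y - g x.\<close>

lemma bounded_variation01_dominated:
  assumes "bounded_variation01 g"
  obtains V :: "real \<Rightarrow> real"
    where "\<And>x y. 0 \<le> x \<Longrightarrow> x \<le> y \<Longrightarrow> y \<le> 1 \<Longrightarrow> norm (g y - g x) \<le> V y - V x"
proof -
  obtain B where B: "\<And>(n::nat) (t::nat \<Rightarrow> real). 0 \<le> t 0 \<Longrightarrow> t n \<le> 1 \<Longrightarrow> (\<forall>i<n. t i \<le> t (Suc i)) \<Longrightarrow>
      (\<Sum>i<n. norm (g (t (Suc i)) - g (t i))) \<le> B"
    using assms unfolding bounded_variation01_def by blast
  define S where "S x = {(\<Sum>i<n. norm (g (t (Suc i)) - g (t i))) |(n::nat) (t::nat \<Rightarrow> real).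
      0 \<le> t 0 \<and> t n \<le> x \<and> (\<forall>i<n. t i \<le> t (Suc i))}" for x
  have bdd: "bdd_above (S x)" if "x \<le> 1" for x
    unfolding S_def using that by (auto intro!: bdd_aboveI[of _ B] B)
  have ne: "S x \<noteq> {}" if "0 \<le> x" for x
    unfolding S_def using that by (auto intro!: exI[of _ 0] exI[of _ "\<lambda>_. 0"])
  have "norm (g y - g x) \<le> Sup (S y) - Sup (S x)" if xy: "0 \<le> x" "x \<le> y" "y \<le> 1" for x y
  proof -
    have "Sup (S x) \<le> Sup (S y) - norm (g y - g x)"
    proof (rule cSup_least[OF ne[OF xy(1)]])
      fix s assume "s \<in> S x"
      then obtain n and t :: "nat \<Rightarrow> real" where s: "s = (\<Sum>i<n. norm (g (t (Suc i)) - g (t i)))"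
        and t: "0 \<le> t 0" "t n \<le> x" "\<forall>i<n. t i \<le> t (Suc i)" unfolding S_def by blast
      define t' where "t' i = (if i \<le> n then t i else if i = Suc n then x else y)" for i
      have "(\<Sum>i<Suc (Suc n). norm (g (t' (Suc i)) - g (t' i))) = s + norm (g x - g (t n)) + norm (g y - g x)"
        by (simp add: s t'_def)
      moreover have "(\<Sum>i<Suc (Suc n). norm (g (t' (Suc i)) - g (t' i))) \<in> S y"
        unfolding S_def mem_Collect_eq using t xy
        by (intro exI[of _ "Suc (Suc n)"] exI[of _ t']) (auto simp: t'_def less_Suc_eq)
      ultimately have "s + norm (g x - g (t n)) + norm (g y - g x) \<le> Sup (S y)"
        using cSup_upper[OF _ bdd[OF xy(3)]] by auto
      then show "s \<le> Sup (S y) - norm (g y - g x)" using norm_ge_zero[of "g x - g (t n)"] by linarith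
    qed
    then show ?thesis by simp
  qed
  then show thesis by (rule that[of "\<lambda>x. Sup (S x)"])
qed

section \<open>Excursions away from \<open>Y\<close>\<close>

text \<open>An inverse branch of order j that uses 1/(1+x) at least once lands in [1/(j+1), 1],
  where g is zero. Only the j-fold composition of x/(1+x) survives.\<close>

lemma farey_op_funpow_vanish:
  assumes "\<And>y. 1 / real (j + 1) \<le> y \<Longrightarrow> y \<le> 1 \<Longrightarrow> g y = 0" "0 < x" "x \<le> 1"
  shows "(farey_op ^^ j) g x = (1 / (1 + real j * x)) *\<^sub>R g (x / (1 + real j * x))"
  using assms
proof (induction j arbitrary: x)
  case (Suc j)
  have IH: "(farey_op ^^ j) g y = (1 / (1 + real j * y)) *\<^sub>R g (y / (1 + real j * y))" if "0 < y" "y \<le> 1" for y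
  proof (rule Suc.IH[OF _ that])
    fix z assume "1 / real (j + 1) \<le> z" "z \<le> 1"
    moreover have "1 / real (Suc j + 1) \<le> 1 / real (j + 1)" by (simp add: field_simps)
    ultimately show "g z = 0" by (intro Suc.prems(1)) auto
  qed
  define a b where "a = x / (1 + x)" and "b = 1 / (1 + x)"
  have ab: "0 < a" "a \<le> 1" "0 < b" "b \<le> 1" using Suc.prems by (auto simp: a_def b_def)
  have eq: "1 + real j * a = (1 + real (Suc j) * x) / (1 + x)"
    using Suc.prems by (simp add: a_def field_simps)
  have pos: "1 + real (Suc j) * x > 0" using Suc.prems by (intro add_pos_nonneg) auto
  have 1: "a / (1 + real j * a) = x / (1 + real (Suc j) * x)"
    unfolding eq using Suc.prems by (simp add: a_def)
  have 2: "(1 / (1 + x)) * (1 / (1 + real j * a)) = 1 / (1 + real (Suc j) * x)"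
    unfolding eq using Suc.prems by simp
  have 3: "b / (1 + real j * b) = 1 / (1 + x + real j)"
    using Suc.prems by (simp add: b_def field_simps)
  have "g (b / (1 + real j * b)) = 0"
    unfolding 3 using Suc.prems(2,3) by (intro Suc.prems(1) divide_left_mono) auto
  then have "(farey_op ^^ Suc j) g x = ((1 / (1 + x)) * (1 / (1 + real j * a))) *\<^sub>R g (a / (1 + real j * a))"
    unfolding farey_op_funpow_Suc a_def[symmetric] b_def[symmetric] IH[OF ab(1,2)] IH[OF ab(3,4)] by simp
  then show ?case unfolding 1 2 .
qed simp

lemma sum_indicator_Yk: "(\<Sum>k\<le>n. indicator (Yk k) y :: 'a::semiring_1) = indicator {1 / real (n + 2)..1} y"
proof (induction n)
  case (Suc n)
  define u v where "u = 1 / real (Suc n + 2)" and "v = 1 / real (n + 2)"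
  have uv: "u \<le> v" "v \<le> 1" by (auto simp: u_def v_def field_simps)
  have Yk: "Yk (Suc n) = {u..<v}" by (simp add: Yk_def u_def v_def)
  have "indicator {v..1} y + indicator {u..<v} y = (indicator {u..1} y :: 'a)"
    using uv by (auto simp: indicator_def)
  then show ?case unfolding sum.atMost_Suc Suc.IH Yk u_def[symmetric] v_def[symmetric] .
qed (simp add: Yk_def Y_def)

text \<open>The only inverse branch of order \<open>k\<close> that meets \<open>Yk k\<close> from \<open>Y\<close> is \<open>x / (1 + k x)\<close>, so this is
  the \<open>k\<close>-th iterate of the transfer operator on functions supported in \<open>Yk k\<close>.\<close>

definition excursion :: "nat \<Rightarrow> (real \<Rightarrow> 'a::real_vector) \<Rightarrow> real \<Rightarrow> 'a" where
  "excursion k g x = indicator Y x *\<^sub>R ((1 / (1 + real k * x)) *\<^sub>R g (x / (1 + real k * x)))"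

text \<open>For k > 0 and x < 1/2 the surviving branch lands below 1/(k+2), outside
  \<open>Yk k\<close>, so the cutoff by the indicator of \<open>Y\<close> changes nothing.\<close>

lemma excursion_eq_farey_op:
  assumes "\<And>y. y \<notin> Yk k \<Longrightarrow> g y = 0" "0 < x" "x \<le> 1"
  shows "(farey_op ^^ k) g x = excursion k g x"
proof (cases "k = 0")
  case True
  then show ?thesis using assms(1)[of x] by (auto simp: excursion_def Yk_def indicator_def)
next
  case False
  have "(farey_op ^^ k) g x = (1 / (1 + real k * x)) *\<^sub>R g (x / (1 + real k * x))"
    using False assms(2,3) by (intro farey_op_funpow_vanish assms(1)) (auto simp: Yk_def)
  moreover have "g (x / (1 + real k * x)) = 0" if "x \<notin> Y"
  proof -
    have x: "x < 1/2" using that assms by (auto simp: Y_def)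
    have "1 + real k * x > 0" using assms by (intro add_pos_nonneg) auto
    then have "x / (1 + real k * x) < 1 / real (k + 2)" using x by (simp add: field_simps)
    then show ?thesis using False by (intro assms(1)) (auto simp: Yk_def)
  qed
  ultimately show ?thesis by (auto simp: excursion_def indicator_def)
qed

lemma branch_image:
  "(\<lambda>x. x / (1 + real k * x)) ` {1/2..1} = {1 / real (k + 2)..1 / real (k + 1)}"
proof safe
  fix x :: real assume x: "x \<in> {1/2..1}"
  have p: "1 + real k * x > 0" using x by (intro add_pos_nonneg) auto
  show "x / (1 + real k * x) \<in> {1 / real (k + 2)..1 / real (k + 1)}" using p x by (simp add: field_simps)
next
  fix y :: real assume y: "y \<in> {1 / real (k + 2)..1 / real (k + 1)}"
  have "0 < 1 / real (k + 2)" by simp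
  also have "\<dots> \<le> y" using y unfolding atLeastAtMost_iff by (rule conjunct1)
  finally have y0: "y > 0" .
  have y1: "1 \<le> y * real (k + 2)" "y * real (k + 1) \<le> 1" using y by (auto simp: field_simps)
  have p: "1 - real k * y > 0" using y1 y0 by (simp add: algebra_simps)
  define x where "x = y / (1 - real k * y)"
  have "1 + real k * x = 1 / (1 - real k * y)" using p by (simp add: x_def field_simps)
  then have "y = x / (1 + real k * x)" using p by (simp add: x_def)
  moreover have "x \<in> {1/2..1}" using y1 p by (simp add: x_def field_simps)
  ultimately show "y \<in> (\<lambda>x. x / (1 + real k * x)) ` {1/2..1}" by blast
qed

text \<open>Substitute y = x/(1+kx): the Jacobian 1/(1+kx)^2 times the density 1/y equals
  1/(x(1+kx)), the weight of the excursion times the density at x.\<close>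

lemma excursion_integral_real:
  fixes g :: "real \<Rightarrow> real"
  assumes int: "integrable mu1 g" and supp: "\<And>y. y \<notin> Yk k \<Longrightarrow> g y = 0"
  shows "integrable mu1 (excursion k g) \<and> integral\<^sup>L mu1 (excursion k g) = integral\<^sup>L mu1 g"
proof -
  define G where "G x = x / (1 + real k * x)" for x
  define S :: "real set" where "S = {1/2..1}"
  define T where "T = {1 / real (k + 2)..1 / real (k + 1)}"
  have GS: "G ` S = T" using branch_image[of k] by (simp add: G_def[abs_def] S_def T_def)
  have p: "1 + real k * x > 0" if "x \<in> S" for x using that by (intro add_pos_nonneg) (auto simp: S_def)
  have gm: "g \<in> borel_measurable lebesgue" using borel_measurable_integrable[OF int] by (simp add: borel_measurable_mu1)
  have T01: "T \<subseteq> {0..1}" by (auto simp: T_def field_simps intro: order_trans[of 0 "1 / real (k + 2)"])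
  have YT: "Yk k \<subseteq> T" by (auto simp: Yk_def Y_def T_def)
  have eqT: "(indicator {0..1} y * h1 y) *\<^sub>R g y = indicator T y *\<^sub>R (h1 y * g y)" for y
    using T01 YT supp[of y] by (auto simp: indicator_def)
  have "integrable lebesgue (\<lambda>y. indicator T y *\<^sub>R (h1 y * g y))"
    using int unfolding integrable_mu1_iff[OF gm] eqT .
  then have aT: "(\<lambda>y. h1 y * g y) absolutely_integrable_on T" by (simp add: set_integrable_def)
  have Ig: "integral\<^sup>L mu1 g = integral T (\<lambda>y. h1 y * g y)"
    unfolding integral_mu1[OF gm] eqT set_lebesgue_integral_eq_integral(2)[OF aT, symmetric]
    by (simp add: set_lebesgue_integral_def)
  have der: "(G has_field_derivative 1 / (1 + real k * x)^2) (at x within S)" if "x \<in> S" for x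
    unfolding G_def[abs_def] using p[OF that]
    by (auto intro!: derivative_eq_intros simp: power2_eq_square field_simps)
  have inj: "inj_on G S"
  proof (rule inj_onI)
    fix x y assume xy: "x \<in> S" "y \<in> S" "G x = G y"
    then have "x * (1 + real k * y) = y * (1 + real k * x)"
      using p[of x] p[of y] by (simp add: G_def frac_eq_eq)
    then show "x = y" by (simp add: algebra_simps)
  qed
  have Sm: "S \<in> sets lebesgue" by (simp add: S_def)
  have cov: "(\<lambda>x. \<bar>1 / (1 + real k * x)^2\<bar> * (h1 (G x) * g (G x))) absolutely_integrable_on S \<and>
     integral S (\<lambda>x. \<bar>1 / (1 + real k * x)^2\<bar> * (h1 (G x) * g (G x))) = integral T (\<lambda>y. h1 y * g y)"
    using has_absolute_integral_change_of_variables_1'[OF Sm der inj, where f = "\<lambda>y. h1 y * g y"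
        and b = "integral T (\<lambda>y. h1 y * g y)"] aT unfolding GS by blast
  have pt: "indicator S x *\<^sub>R (\<bar>1 / (1 + real k * x)^2\<bar> * (h1 (G x) * g (G x))) =
      (indicator {0..1} x * h1 x) *\<^sub>R excursion k g x" for x
  proof (cases "x \<in> S")
    case True
    then have "x > 0" "x \<le> 1" "x \<in> Y" by (auto simp: S_def Y_def)
    then show ?thesis using True p[OF True]
      by (simp add: excursion_def h1_def G_def power2_eq_square)
  next
    case False
    then show ?thesis by (simp add: excursion_def S_def Y_def)
  qed
  have i: "integrable lebesgue (\<lambda>x. (indicator {0..1} x * h1 x) *\<^sub>R excursion k g x)"
    using cov unfolding set_integrable_def pt by blast
  \<comment> \<open>Multiplying the integrand by x removes the density again, which yields
    measurability of the excursion itself.\<close>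
  have "(\<lambda>x. x * ((indicator {0..1} x * h1 x) *\<^sub>R excursion k g x)) \<in> borel_measurable lebesgue"
    by (rule borel_measurable_times[OF measurable_completion borel_measurable_integrable[OF i]]) simp
  also have "(\<lambda>x. x * ((indicator {0..1} x * h1 x) *\<^sub>R excursion k g x)) = excursion k g"
    by (auto simp: excursion_def Y_def h1_def indicator_def)
  finally have m: "excursion k g \<in> borel_measurable lebesgue" .
  have "integral\<^sup>L mu1 (excursion k g) = integral T (\<lambda>y. h1 y * g y)"
    unfolding integral_mu1[OF m] pt[symmetric]
    using set_lebesgue_integral_eq_integral(2)[OF conjunct1[OF cov]] cov
    by (simp add: set_lebesgue_integral_def)
  then show ?thesis using i integrable_mu1_iff[OF m] Ig by simp
qed

lemma excursion_integral_complex: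
  fixes g :: "real \<Rightarrow> complex"
  assumes int: "integrable mu1 g" and supp: "\<And>y. y \<notin> Yk k \<Longrightarrow> g y = 0"
  shows "integrable mu1 (excursion k g)" "integral\<^sup>L mu1 (excursion k g) = integral\<^sup>L mu1 g"
proof -
  have re: "integrable mu1 (excursion k (\<lambda>x. Re (g x))) \<and>
      integral\<^sup>L mu1 (excursion k (\<lambda>x. Re (g x))) = integral\<^sup>L mu1 (\<lambda>x. Re (g x))"
    using supp by (intro excursion_integral_real integrable_Re int) auto
  have im: "integrable mu1 (excursion k (\<lambda>x. Im (g x))) \<and>
      integral\<^sup>L mu1 (excursion k (\<lambda>x. Im (g x))) = integral\<^sup>L mu1 (\<lambda>x. Im (g x))"
    using supp by (intro excursion_integral_real integrable_Im int) auto
  have eq: "excursion k g = (\<lambda>x. complex_of_real (excursion k (\<lambda>x. Re (g x)) x) +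
      \<i> * complex_of_real (excursion k (\<lambda>x. Im (g x)) x))"
    by (rule ext) (simp add: excursion_def complex_eq_iff)
  show i: "integrable mu1 (excursion k g)" unfolding eq using re im by auto
  have "Re (integral\<^sup>L mu1 (excursion k g)) = integral\<^sup>L mu1 (\<lambda>x. Re (excursion k g x))"
     "Im (integral\<^sup>L mu1 (excursion k g)) = integral\<^sup>L mu1 (\<lambda>x. Im (excursion k g x))"
    using i by simp_all
  moreover have "(\<lambda>x. Re (excursion k g x)) = excursion k (\<lambda>x. Re (g x))"
     "(\<lambda>x. Im (excursion k g x)) = excursion k (\<lambda>x. Im (g x))"
    by (auto simp: excursion_def)
  ultimately show "integral\<^sup>L mu1 (excursion k g) = integral\<^sup>L mu1 g"
    using re im int by (simp add: complex_eq_iff)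
qed

section \<open>Limit of the convolution over excursion lengths\<close>

text \<open>Summability of \<open>b\<close> alone does not control the terms with \<open>n - k\<close> small, where \<open>ln n * c (n - k)\<close>
  is unbounded; for \<open>n - k < sqrt n\<close> the bound \<open>b k = O(1/k)\<close> takes over.\<close>

lemma renewal_convolution_limit:
  fixes a :: "nat \<Rightarrow> nat \<Rightarrow> complex" and b c :: "nat \<Rightarrow> real"
  assumes lim: "\<And>k. (\<lambda>m. ln (real m) *\<^sub>R a k m) \<longlonglongrightarrow> I k" and J: "I sums J"
    and bound: "\<And>k m. norm (a k m) \<le> b k * c m"
    and b: "\<And>k. 0 \<le> b k" "summable b" "\<And>k. b k \<le> D / real (k + 1)"
    and c: "\<And>m. 0 \<le> c m" "\<And>m. c m * ln (real (m + 2)) \<le> C"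
  shows "(\<lambda>n. ln (real n) *\<^sub>R (\<Sum>k\<le>n. a k (n - k))) \<longlonglongrightarrow> J"
proof -
  \<comment> \<open>The condition n - k \<ge> sqrt n, written without truncated subtraction.\<close>
  define P where "P k n \<longleftrightarrow> real k + sqrt (real n) \<le> real n" for k n :: nat
  have C0: "0 \<le> C" using order_trans[OF _ c(2)[of 0]] c(1)[of 0] by simp
  have D0: "0 \<le> D" using order_trans[OF b(1) b(3), of 0] by simp
  have cle: "c m \<le> C / ln (real (m + 2))" for m using c(2)[of m] by (simp add: field_simps)
  define A where "A k n = (if P k n then ln (real n) *\<^sub>R a k (n - k) else 0)" for k n
  have A_lim: "(\<lambda>n. A k n) \<longlonglongrightarrow> I k" for k
  proof -
    have r: "(\<lambda>m. ln (real (m + k)) / ln (real m)) \<longlonglongrightarrow> 1" by real_asymp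
    have "(\<lambda>m. (ln (real (m + k)) / ln (real m)) *\<^sub>R (ln (real m) *\<^sub>R a k m)) \<longlonglongrightarrow> 1 *\<^sub>R I k"
      by (intro tendsto_scaleR r lim)
    moreover have "\<forall>\<^sub>F m in sequentially. (ln (real (m + k)) / ln (real m)) *\<^sub>R (ln (real m) *\<^sub>R a k m)
        = ln (real (m + k)) *\<^sub>R a k (m + k - k)"
      using eventually_gt_at_top[of 1] by eventually_elim simp
    ultimately have "(\<lambda>m. ln (real (m + k)) *\<^sub>R a k (m + k - k)) \<longlonglongrightarrow> 1 *\<^sub>R I k"
      by (rule Lim_transform_eventually)
    then have "(\<lambda>n. ln (real n) *\<^sub>R a k (n - k)) \<longlonglongrightarrow> 1 *\<^sub>R I k" by (rule LIMSEQ_offset)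
    moreover have "\<forall>\<^sub>F n in sequentially. P k n" unfolding P_def by real_asymp
    then have "\<forall>\<^sub>F n in sequentially. ln (real n) *\<^sub>R a k (n - k) = A k n"
      by eventually_elim (simp add: A_def)
    ultimately have "(\<lambda>n. A k n) \<longlonglongrightarrow> 1 *\<^sub>R I k" by (rule Lim_transform_eventually)
    then show ?thesis by simp
  qed
  have A_bound: "norm (A k n) \<le> 2 * C * b k" for k n
  proof (cases "P k n \<and> n > 1")
    case True
    then have n: "sqrt (real n) \<le> real (n - k)" "n > 1" by (auto simp: P_def)
    \<comment> \<open>On this range ln n = 2 ln (sqrt n) is comparable to ln (n - k + 2), so the
      decay of c absorbs it.\<close>
    have "ln (real n) / 2 = ln (sqrt (real n))" using n by (simp add: ln_sqrt)
    also have "\<dots> \<le> ln (real (n - k + 2))" using n by (intro ln_mono) (auto intro: order_trans)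
    finally have l: "ln (real n) \<le> 2 * ln (real (n - k + 2))" by simp
    have "norm (A k n) = ln (real n) * norm (a k (n - k))" using True by (simp add: A_def)
    also have "\<dots> \<le> (2 * ln (real (n - k + 2))) * (b k * c (n - k))"
      using l n bound by (intro mult_mono) auto
    also have "\<dots> = 2 * b k * (c (n - k) * ln (real (n - k + 2)))" by simp
    also have "\<dots> \<le> 2 * b k * C" using b by (intro mult_left_mono c(2)) auto
    finally show ?thesis by (simp add: mult_ac)
  next
    case False
    then have "A k n = 0" by (cases "n = 0"; cases "n = 1") (auto simp: A_def)
    then show ?thesis using C0 b(1)[of k] by simp
  qed
  \<comment> \<open>Dominated convergence for series, with the summable majorant 2 C b(k).\<close>
  have "(\<lambda>n. \<Sum>k. A k n) \<longlonglongrightarrow> (\<Sum>k. I k)"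
    by (rule conjunct2[OF conjunct2[OF tannerys_theorem[OF A_lim, where M = "\<lambda>k. 2 * C * b k"]]])
      (use A_bound b(2) in \<open>auto intro!: always_eventually\<close>)
  moreover have "(\<Sum>k. A k n) = (\<Sum>k\<le>n. A k n)" for n
  proof (rule suminf_finite)
    fix k assume "k \<notin> {..n}"
    then have "real n < real k" by simp
    moreover have "0 \<le> sqrt (real n)" by simp
    ultimately have "\<not> P k n" unfolding P_def by linarith
    then show "A k n = 0" by (simp add: A_def)
  qed simp
  ultimately have main: "(\<lambda>n. \<Sum>k\<le>n. A k n) \<longlonglongrightarrow> J" using sums_unique[OF J] by simp
  \<comment> \<open>The terms with n - k < sqrt n: at most sqrt n + 1 of them, each of order ln n /
    (n - sqrt n + 1).\<close>
  define R where "R n = (\<Sum>k\<le>n. ln (real n) *\<^sub>R a k (n - k) - A k n)" for n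
  have R_bound: "norm (R n) \<le> ln (real n) * (C / ln 2 * D) * ((sqrt (real n) + 1) / (real n - sqrt (real n) + 1))"
    if n: "n > 1" for n
  proof -
    define m where "m = n - nat \<lfloor>sqrt (real n)\<rfloor>"
    have sq: "sqrt (real n) \<le> real n" using n
      by (intro real_le_lsqrt self_le_power) auto
    have q0: "real n - sqrt (real n) + 1 > 0" using sq by linarith
    have term_le: "norm (ln (real n) *\<^sub>R a k (n - k) - A k n) \<le>
       (if k \<in> {m..n} then ln (real n) * (C / ln 2 * D) / (real n - sqrt (real n) + 1) else 0)" if k: "k \<le> n" for k
    proof (cases "P k n")
      case True
      then show ?thesis using q0 C0 D0 n by (simp add: A_def)
    next
      case False
      then have nk: "real n - sqrt (real n) < real k" by (simp add: P_def)
      have "real (n - k) < sqrt (real n)" using nk k by (simp add: of_nat_diff)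
      then have "n - k \<le> nat \<lfloor>sqrt (real n)\<rfloor>" by (simp add: le_nat_floor)
      then have km: "k \<in> {m..n}" using k by (auto simp: m_def)
      have "c (n - k) \<le> C / ln (real (n - k + 2))" by (rule cle)
      also have "\<dots> \<le> C / ln 2" using C0 by (intro divide_left_mono mult_pos_pos) auto
      finally have c2: "c (n - k) \<le> C / ln 2" .
      have "b k \<le> D / (real n - sqrt (real n) + 1)"
        using b(3)[of k] divide_left_mono[of "real n - sqrt (real n) + 1" "real (k + 1)" D] nk D0 q0
        by (auto intro: order_trans)
      then have "norm (a k (n - k)) \<le> D / (real n - sqrt (real n) + 1) * (C / ln 2)"
        using c2 c(1) D0 q0 by (intro order_trans[OF bound] mult_mono) auto
      then have "ln (real n) * norm (a k (n - k)) \<le> ln (real n) * (D / (real n - sqrt (real n) + 1) * (C / ln 2))"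
        using n by (intro mult_left_mono) auto
      then show ?thesis using False km n by (simp add: A_def mult_ac)
    qed
    have "norm (R n) \<le> (\<Sum>k\<le>n. norm (ln (real n) *\<^sub>R a k (n - k) - A k n))"
      unfolding R_def by (rule norm_sum)
    also have "\<dots> \<le> (\<Sum>k\<le>n. if k \<in> {m..n} then ln (real n) * (C / ln 2 * D) / (real n - sqrt (real n) + 1) else 0)"
      by (intro sum_mono term_le) auto
    also have "\<dots> = real (card ({..n} \<inter> {m..n})) * (ln (real n) * (C / ln 2 * D) / (real n - sqrt (real n) + 1))"
      by (subst sum.inter_restrict[symmetric]) auto
    also have "\<dots> \<le> (sqrt (real n) + 1) * (ln (real n) * (C / ln 2 * D) / (real n - sqrt (real n) + 1))"
    proof (rule mult_right_mono)
      have "card ({..n} \<inter> {m..n}) \<le> card {m..n}" by (intro card_mono) auto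
      also have "\<dots> \<le> nat \<lfloor>sqrt (real n)\<rfloor> + 1" by (auto simp: m_def)
      finally have "real (card ({..n} \<inter> {m..n})) \<le> real (nat \<lfloor>sqrt (real n)\<rfloor> + 1)" by linarith
      also have "\<dots> \<le> sqrt (real n) + 1" by simp
      finally show "real (card ({..n} \<inter> {m..n})) \<le> sqrt (real n) + 1" .
    qed (use n C0 D0 q0 in auto)
    finally show ?thesis by (simp add: mult_ac)
  qed
  have "R \<longlonglongrightarrow> 0"
  proof (rule Lim_null_comparison)
    show "\<forall>\<^sub>F n in sequentially. norm (R n) \<le> ln (real n) * (C / ln 2 * D) * ((sqrt (real n) + 1) / (real n - sqrt (real n) + 1))"
      using eventually_gt_at_top[of 1] by eventually_elim (rule R_bound)
    have "(\<lambda>n. ln (real n) * ((sqrt (real n) + 1) / (real n - sqrt (real n) + 1))) \<longlonglongrightarrow> 0" by real_asymp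
    from tendsto_mult_right_zero[OF this, of "C / ln 2 * D"]
    show "(\<lambda>n. ln (real n) * (C / ln 2 * D) * ((sqrt (real n) + 1) / (real n - sqrt (real n) + 1))) \<longlonglongrightarrow> 0"
      by (simp add: mult_ac)
  qed
  from tendsto_add[OF main this] show ?thesis
    by (simp add: R_def sum_subtractf scaleR_sum_right)
qed

section \<open>Assembling the limit from the excursions\<close>

theorem theorem4p13:
  fixes f :: "real \<Rightarrow> complex"
  assumes bdd: "bounded (f ` {0..1})"
    and int: "integrable mu1 f"
    and bv: "\<And>k. BV_Y ((That1 ^^ k) (\<lambda>x. indicator (Yk k) x * f x))"
    and sum: "summable (\<lambda>k. supnorm ((That1 ^^ k) (\<lambda>x. indicator (Yk k) x * f x)))"
  shows "\<forall>x\<in>Y. (\<lambda>n. complex_of_real (ln (real n)) * (That1 ^^ n) f x)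
           \<longlonglongrightarrow> integral\<^sup>L mu1 f"
proof
  fix x assume x: "x \<in> Y"
  then have x01: "0 < x" "x \<le> 1" "1 / real 2 \<le> x" by (auto simp: Y_def)
  define F where "F k y = indicator (Yk k) y * f y" for k y
  \<comment> \<open>\<open>v k\<close> is the function of the hypotheses, \<open>w k\<close> its
    explicit formula. They agree on (0, 1], and \<open>w k\<close> vanishes off \<open>Y\<close> by
    construction.\<close>
  define v where "v k = (That1 ^^ k) (F k)" for k
  define w where "w k = excursion k (F k)" for k
  have v_def': "v k = (That1 ^^ k) (\<lambda>x. indicator (Yk k) x * f x)" for k
    by (simp add: v_def F_def[abs_def])
  have supp: "F k y = 0" if "y \<notin> Yk k" for k y using that by (simp add: F_def)
  have vw: "(farey_op ^^ k) (F k) y = w k y" "v k y = w k y" if "0 < y" "y \<le> 1" for k y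
    using that excursion_eq_farey_op[OF supp that] by (simp_all add: v_def w_def That1_funpow_eq)
  have Yk01: "Yk k \<subseteq> {0..1}" for k
  proof -
    define u v where "u = 1 / real (k + 2)" and "v = 1 / real (k + 1)"
    have "0 \<le> u" "v \<le> 1" by (auto simp: u_def v_def)
    then show ?thesis unfolding Yk_def Y_def u_def[symmetric] v_def[symmetric] by auto
  qed
  obtain M where M: "M > 0" "\<And>y. y \<in> {0..1} \<Longrightarrow> norm (f y) \<le> M"
    using bdd unfolding bounded_pos by auto
  have FM: "norm (F k y) \<le> M" for k y
    using M Yk01[of k] by (auto simp: F_def indicator_def)
  have F_int: "integrable mu1 (F k)" for k
  proof -
    have "Yk k \<in> sets mu1" by (simp add: Yk_def Y_def)
    from integrable_mult_indicator[OF this int]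
    have "integrable mu1 (\<lambda>y. indicat_real (Yk k) y *\<^sub>R f y)" .
    moreover have "(\<lambda>y. indicat_real (Yk k) y *\<^sub>R f y) = F k"
      by (rule ext) (simp add: F_def indicator_def)
    ultimately show ?thesis by simp
  qed
  have w_int: "integrable mu1 (w k)" "integral\<^sup>L mu1 (w k) = integral\<^sup>L mu1 (F k)" for k
    unfolding w_def by (rule excursion_integral_complex[OF F_int supp]; assumption)+
  have "\<exists>V :: real \<Rightarrow> real. \<forall>p q. 0 \<le> p \<longrightarrow> p \<le> q \<longrightarrow> q \<le> 1 \<longrightarrow> norm (v k q - v k p) \<le> V q - V p" for k
  proof -
    have "bounded_variation01 (v k)" using bv[of k] unfolding BV_Y_def v_def' by blast
    then show ?thesis by (rule bounded_variation01_dominated) blast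
  qed
  then obtain V where V: "\<And>k p q. 0 \<le> p \<Longrightarrow> p \<le> q \<Longrightarrow> q \<le> 1 \<Longrightarrow> norm (v k q - v k p) \<le> V k q - (V k p :: real)"
    by metis
  have w_asymp: "farey_asymp (w k)" for k
  proof (rule farey_asymp_bounded_variation[where V = "V k"])
    show "integrable mu1 (w k)" by (rule w_int)
    show "w k y = 0" if "0 < y" "y \<le> 1 / 4" for y using that by (simp add: w_def excursion_def Y_def)
    show "norm (w k q - w k p) \<le> V k q - V k p" if "1 / 4 \<le> p" "p \<le> q" "q \<le> 1" for p q
      using V[of p q k] vw(2)[of p k] vw(2)[of q k] that by simp
  qed
  \<comment> \<open>The supremum in \<open>supnorm\<close> bounds the values only once these are
    known to be bounded, which finite variation provides.\<close>
  have v_sup: "norm (v k y) \<le> supnorm (v k)" if "y \<in> {0..1}" for k y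
    unfolding supnorm_def
  proof (rule cSUP_upper[OF that bdd_aboveI2])
    fix z :: real assume z: "z \<in> {0..1}"
    have "norm (v k z - v k 0) \<le> V k z - V k 0" using z by (intro V) auto
    moreover have "norm (v k 1 - v k z) \<le> V k 1 - V k z" using z by (intro V) auto
    moreover have "norm (v k z) \<le> norm (v k z - v k 0) + norm (v k 0)" by (metis diff_add_cancel norm_triangle_ineq)
    ultimately show "norm (v k z) \<le> norm (v k 0) + (V k 1 - V k 0)"
      using norm_ge_zero[of "v k 1 - v k z"] by linarith
  qed
  \<comment> \<open>The first bound is summable. The second comes from the sup bound M on f and from
    1 + k y \<ge> (1 + k)/2 on \<open>Y\<close>.\<close>
  define b where "b k = min (supnorm (v k)) (2 * M / real (k + 1))" for k
  have b0: "0 \<le> b k" for k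
    using order_trans[OF norm_ge_zero v_sup[of 1 k]] M(1) by (simp add: b_def)
  have b_sum: "summable b"
    by (rule summable_comparison_test'[OF sum, of 0]) (use b0 in \<open>auto simp: b_def v_def'\<close>)
  have w_le: "norm (w k y) \<le> b k * indicator {1/4<..1} y" if y: "0 < y" "y \<le> 1" for k y
  proof (cases "y \<in> Y")
    case True
    then have y2: "1 / 2 \<le> y" by (simp add: Y_def)
    have "norm (w k y) \<le> supnorm (v k)" using v_sup[of y k] vw(2)[OF y] y by simp
    moreover have "norm (w k y) \<le> 2 * M / real (k + 1)"
    proof -
      have "real k * (1 / 2) \<le> real k * y" using y2 by (intro mult_left_mono) auto
      then have p: "(1 + real k) / 2 \<le> 1 + real k * y" by (simp add: field_simps)
      have p0: "1 + real k * y > 0" using y by (intro add_pos_nonneg) auto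
      have "norm (w k y) = norm (F k (y / (1 + real k * y))) / (1 + real k * y)"
        using True p0 by (simp add: w_def excursion_def)
      also have "\<dots> \<le> M / ((1 + real k) / 2)" using FM M(1) p by (intro frac_le) auto
      finally show ?thesis by (simp add: field_simps)
    qed
    ultimately show ?thesis using y2 y by (simp add: b_def)
  next
    case False
    then show ?thesis using b0 by (simp add: w_def excursion_def)
  qed
  \<comment> \<open>The interval (1/4, 1] covers \<open>Y\<close> and has an indicator of known
    asymptotics, so one sequence controls the iterates of all \<open>w k\<close>.\<close>
  define c where "c m = (farey_op ^^ m) (indicator {1/4<..1} :: real \<Rightarrow> real) x" for m
  have a_le: "norm ((farey_op ^^ m) (w k) x) \<le> b k * c m" for k m
  proof -
    have "norm ((farey_op ^^ m) (w k) x) \<le> (farey_op ^^ m) (\<lambda>y. b k * indicator {1/4<..1} y) x"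
      using x01 by (intro farey_op_funpow_norm_le w_le) auto
    also have "\<dots> = b k * c m"
      using farey_op_funpow_linear[OF bounded_linear.linear[OF bounded_linear_mult_right], of m "b k"]
      by (simp add: c_def)
    finally show ?thesis .
  qed
  have c0: "0 \<le> c m" for m
  proof -
    have "norm ((farey_op ^^ m) (\<lambda>_. 0 :: real) x) \<le> c m"
      unfolding c_def using x01 by (intro farey_op_funpow_norm_le) auto
    then show ?thesis using norm_ge_zero by (rule order_trans[rotated])
  qed
  obtain C where C: "\<And>m. c m * ln (real (m + 2)) \<le> C"
  proof -
    obtain L where L: "(\<lambda>m. ln (real m) * c m) \<longlonglongrightarrow> L"
      using farey_asymp_indicator[of "1/4"] x unfolding farey_asymp_def c_def by auto
    have r: "(\<lambda>m. ln (real (m + 2)) / ln (real m)) \<longlonglongrightarrow> 1" by real_asymp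
    have "\<forall>\<^sub>F m in sequentially. ln (real (m + 2)) / ln (real m) * (ln (real m) * c m) = c m * ln (real (m + 2))"
      using eventually_gt_at_top[of 1] by eventually_elim simp
    from Lim_transform_eventually[OF tendsto_mult[OF r L] this]
    have "Bseq (\<lambda>m. c m * ln (real (m + 2)))" by (intro convergent_imp_Bseq convergentI)
    then obtain K where "\<And>m. norm (c m * ln (real (m + 2))) \<le> K" by (auto simp: Bseq_def)
    then show thesis by (intro that[of K]) (metis abs_le_D1 real_norm_def)
  qed
  have sF: "(\<Sum>k\<le>n. F k y) = indicator {1 / real (n + 2)..1} y * f y" for n y
    unfolding F_def sum_distrib_right[symmetric] sum_indicator_Yk ..
  \<comment> \<open>The sets \<open>Yk k\<close> partition (0, 1] and excursions preserve integrals,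
    so dominated convergence by the norm of f applies.\<close>
  have sums: "(\<lambda>k. integral\<^sup>L mu1 (w k)) sums integral\<^sup>L mu1 f"
    unfolding sums_def_le
  proof -
    have "(\<Sum>k\<le>n. integral\<^sup>L mu1 (w k)) = integral\<^sup>L mu1 (\<lambda>y. \<Sum>k\<le>n. F k y)" for n
      by (simp add: w_int F_int)
    moreover have "(\<lambda>n. integral\<^sup>L mu1 (\<lambda>y. \<Sum>k\<le>n. F k y)) \<longlonglongrightarrow> integral\<^sup>L mu1 f"
    proof (rule integral_dominated_convergence[where w = "\<lambda>y. norm (f y)"])
      show "AE y in mu1. (\<lambda>n. \<Sum>k\<le>n. F k y) \<longlonglongrightarrow> f y"
        using AE_mu1
      proof eventually_elim
        case (elim y)
        have "(\<lambda>n. 1 / real (n + 2)) \<longlonglongrightarrow> 0" by real_asymp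
        then have "\<forall>\<^sub>F n in sequentially. 1 / real (n + 2) < y" using elim by (intro order_tendstoD(2)) auto
        then have "\<forall>\<^sub>F n in sequentially. (\<Sum>k\<le>n. F k y) = f y"
          unfolding sF by eventually_elim (use elim in simp)
        then show ?case by (rule tendsto_eventually)
      qed
      show "AE y in mu1. norm (\<Sum>k\<le>n. F k y) \<le> norm (f y)" for n
        unfolding sF by (auto simp: indicator_def)
      show "f \<in> borel_measurable mu1" using int by (rule borel_measurable_integrable)
      show "(\<lambda>y. \<Sum>k\<le>n. F k y) \<in> borel_measurable mu1" for n
        by (intro borel_measurable_sum borel_measurable_integrable F_int)
    qed (use int in simp)
    ultimately show "(\<lambda>n. \<Sum>k\<le>n. integral\<^sup>L mu1 (w k)) \<longlonglongrightarrow> integral\<^sup>L mu1 f" by simp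
  qed
  \<comment> \<open>By locality, on \<open>Y\<close> the n-th iterate sees f only on [1/(n+2), 1],
    the union of the \<open>Yk k\<close> with k \<le> n. The first k steps turn each piece into its
    excursion.\<close>
  have dec: "(That1 ^^ n) f x = (\<Sum>k\<le>n. (farey_op ^^ (n - k)) (w k) x)" for n
  proof -
    have "(That1 ^^ n) f x = (farey_op ^^ n) f x" by (rule That1_funpow_eq[OF x01(1)])
    also have "\<dots> = (farey_op ^^ n) (\<lambda>y. \<Sum>k\<le>n. F k y) x"
    proof (rule farey_op_funpow_cong_local[of 2])
      fix y assume "1 / real (2 + n) \<le> y" "y \<le> 1"
      then show "f y = (\<Sum>k\<le>n. F k y)" by (simp add: sF add.commute)
    qed (use x01 in auto)
    also have "\<dots> = (\<Sum>k\<le>n. (farey_op ^^ n) (F k) x)" by (simp add: farey_op_funpow_sum)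
    also have "\<dots> = (\<Sum>k\<le>n. (farey_op ^^ (n - k)) (w k) x)"
    proof (rule sum.cong[OF refl])
      fix k assume "k \<in> {..n}"
      then have "(farey_op ^^ n) (F k) x = (farey_op ^^ (n - k)) ((farey_op ^^ k) (F k)) x"
        using funpow_add[of "n - k" k "farey_op :: (real \<Rightarrow> complex) \<Rightarrow> _"] by simp
      also have "\<dots> = (farey_op ^^ (n - k)) (w k) x"
      proof (rule farey_op_funpow_cong_local[of 2])
        fix y assume "1 / real (2 + (n - k)) \<le> y" "y \<le> 1"
        moreover have "0 < 1 / real (2 + (n - k))" by simp
        ultimately show "(farey_op ^^ k) (F k) y = w k y" by (intro vw(1)) linarith+
      qed (use x01 in auto)
      finally show "(farey_op ^^ n) (F k) x = (farey_op ^^ (n - k)) (w k) x" .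
    qed
    finally show ?thesis .
  qed
  have "(\<lambda>n. ln (real n) *\<^sub>R (\<Sum>k\<le>n. (farey_op ^^ (n - k)) (w k) x)) \<longlonglongrightarrow> integral\<^sup>L mu1 f"
  proof (rule renewal_convolution_limit[where b = b and c = c and D = "2 * M" and C = C, OF _ sums a_le b0 b_sum _ c0 C])
    show "(\<lambda>m. ln (real m) *\<^sub>R (farey_op ^^ m) (w k) x) \<longlonglongrightarrow> integral\<^sup>L mu1 (w k)" for k
      using w_asymp[of k] x by (simp add: farey_asymp_def)
    show "b k \<le> 2 * M / real (k + 1)" for k by (simp add: b_def)
  qed
  then show "(\<lambda>n. complex_of_real (ln (real n)) * (That1 ^^ n) f x) \<longlonglongrightarrow> integral\<^sup>L mu1 f"
    by (simp add: dec scaleR_conv_of_real)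
qed

end
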